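(* The unique minimizer $K^*_\lambda$ of the Lagrangian $\mathcal L(\cdot,\lambda)$ over $\mathcal S$ and the constrained costs $J_i(K^*_\lambda)$, $i\in\{1,\dots,N\}$, are continuous functions of $\lambda$ over $\mathbb R^N_+$.
   Context: Consider the discrete-time linear system $x_{t+1}=Ax_t+Bu_t$, with state $x_t\in\mathbb R^n$, input $u_t\in\mathbb R^m$, $(A,B)$ controllable, and random initial state $x_0$ with zero mean and $\mathbb E[x_0x_0^\top]=I_n$. Let $Q_0,R_0>0$ (symmetric positive definite) and $Q_i,R_i\ge 0$ (symmetric positive semidefinite) for $i\in\{1,\dots,N\}$, where $Q_i\in\mathbb R^{n\times n}$, $R_i\in\mathbb R^{m\times m}$, and let $c_1,\dots,c_N$ be real constants. For $K\in\mathbb R^{m\times n}$ and $i\in\{0,\dots,N\}$ let $J_i(K)=\mathbb E_{x_0}\big[\sum_{t=0}^\infty (x_t^\top Q_ix_t+u_t^\top R_iu_t)\big]$ under the state feedback $u_t=-Kx_t$. Let $\rho(\cdot)$ be the spectral radius and $\mathcal S=\{K\in\mathbb R^{m\times n}:\rho(A-BK)<1\}$. For $\lambda\in\mathbb R^N_+$ (entrywise nonnegative vectors), $\mathcal L(K,\lambda)=J_0(K)+\sum_{i=1}^N\lambda_i(J_i(K)-c_i)$. Set $Q_\lambda=Q_0+\sum_i\lambda_iQ_i$ and $R_\lambda=R_0+\sum_i\lambda_iR_i$. The unique minimizer of $\mathcal L(\cdot,\lambda)$ over $\mathcal S$ is $K^*_\lambda=(R_\lambda+B^\top P^*_\lambda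 B)^{-1}B^\top P^*_\lambda A$, where $P^*_\lambda$ is the positive definite solution of $P=A^\top PA+Q_\lambda-A^\top PB(R_\lambda+B^\top PB)^{-1}B^\top PA$. *)

theory Defs
  imports "HOL-Probability.Probability"
begin

definition pos_semidef :: "real^'n^'n \<Rightarrow> bool" where
  "pos_semidef M \<longleftrightarrow> transpose M = M \<and> (\<forall>x. 0 \<le> x \<bullet> (M *v x))"

definition pos_def :: "real^'n^'n \<Rightarrow> bool" where
  "pos_def M \<longleftrightarrow> transpose M = M \<and> (\<forall>x. x \<noteq> 0 \<longrightarrow> 0 < x \<bullet> (M *v x))"

definition outer :: "real^'n \<Rightarrow> real^'n^'n" where
  "outer x = (\<chi> i j. x $ i * x $ j)"

text \<open>The eigenvalues are the complex ones, hence the entrywise embedding into complex matrices.\<close>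

definition spectrum :: "real^'n^'n \<Rightarrow> complex set" where
  "spectrum M = {z. \<exists>v :: complex^'n. v \<noteq> 0 \<and> (\<chi> i j. complex_of_real (M $ i $ j)) *v v = z *s v}"

definition spectral_radius :: "real^'n^'n \<Rightarrow> real" where
  "spectral_radius M = Max (cmod ` spectrum M)"

primrec trajectory :: "real^'n^'n \<Rightarrow> real^'m^'n \<Rightarrow> (nat \<Rightarrow> real^'m) \<Rightarrow> real^'n \<Rightarrow> nat \<Rightarrow> real^'n" where
  "trajectory A B u x 0 = x"
| "trajectory A B u x (Suc t) = A *v trajectory A B u x t + B *v u t"

text \<open>Controllability in the sense of state transfer: every state can be steered to every other
  state in finite time (equivalent to the Kalman rank condition).\<close>

definition controllable :: "real^'n^'n \<Rightarrow> real^'m^'n \<Rightarrow> bool" where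
  "controllable A B \<longleftrightarrow> (\<forall>x y. \<exists>u T. trajectory A B u x T = y)"

primrec closed_loop :: "real^'n^'n \<Rightarrow> real^'m^'n \<Rightarrow> real^'n^'m \<Rightarrow> real^'n \<Rightarrow> nat \<Rightarrow> real^'n" where
  "closed_loop A B K x 0 = x"
| "closed_loop A B K x (Suc t) = A *v closed_loop A B K x t + B *v (- (K *v closed_loop A B K x t))"

definition stabilizing :: "real^'n^'n \<Rightarrow> real^'m^'n \<Rightarrow> (real^'n^'m) set" where
  "stabilizing A B = {K. spectral_radius (A - B ** K) < 1}"

definition stage_cost :: "real^'n^'n \<Rightarrow> real^'m^'m \<Rightarrow> real^'n \<Rightarrow> real^'m \<Rightarrow> real" where
  "stage_cost Q R x u = x \<bullet> (Q *v x) + u \<bullet> (R *v u)"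

text \<open>For an initial state with finite second moments, the series and the expectation below
  converge whenever K is stabilizing; the value is irrelevant for other K, where the cost
  may be infinite.\<close>

definition cost :: "'a measure \<Rightarrow> ('a \<Rightarrow> real^'n) \<Rightarrow> real^'n^'n \<Rightarrow> real^'m^'n \<Rightarrow>
    real^'n^'n \<Rightarrow> real^'m^'m \<Rightarrow> real^'n^'m \<Rightarrow> real" where
  "cost M x0 A B Q R K =
     (\<integral>w. (\<Sum>t. let x = closed_loop A B K (x0 w) t in stage_cost Q R x (- (K *v x))) \<partial>M)"

definition lagrangian :: "'a measure \<Rightarrow> ('a \<Rightarrow> real^'n) \<Rightarrow> real^'n^'n \<Rightarrow> real^'m^'n \<Rightarrow>
    real^'n^'n \<Rightarrow> real^'m^'m \<Rightarrow> ('k \<Rightarrow> real^'n^'n) \<Rightarrow> ('k \<Rightarrow> real^'m^'m) \<Rightarrow> ('k \<Rightarrow> real) \<Rightarrow>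
    real^'n^'m \<Rightarrow> real^'k \<Rightarrow> real" where
  "lagrangian M x0 A B Q0 R0 Q R c K l =
     cost M x0 A B Q0 R0 K + (\<Sum>i\<in>UNIV. l $ i * (cost M x0 A B (Q i) (R i) K - c i))"

definition is_minimizer :: "'a measure \<Rightarrow> ('a \<Rightarrow> real^'n) \<Rightarrow> real^'n^'n \<Rightarrow> real^'m^'n \<Rightarrow>
    real^'n^'n \<Rightarrow> real^'m^'m \<Rightarrow> ('k \<Rightarrow> real^'n^'n) \<Rightarrow> ('k \<Rightarrow> real^'m^'m) \<Rightarrow> ('k \<Rightarrow> real) \<Rightarrow>
    real^'k \<Rightarrow> real^'n^'m \<Rightarrow> bool" where
  "is_minimizer M x0 A B Q0 R0 Q R c l K \<longleftrightarrow>
     is_arg_min (\<lambda>K. lagrangian M x0 A B Q0 R0 Q R c K l) (\<lambda>K. K \<in> stabilizing A B) K"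

definition K_star :: "'a measure \<Rightarrow> ('a \<Rightarrow> real^'n) \<Rightarrow> real^'n^'n \<Rightarrow> real^'m^'n \<Rightarrow>
    real^'n^'n \<Rightarrow> real^'m^'m \<Rightarrow> ('k \<Rightarrow> real^'n^'n) \<Rightarrow> ('k \<Rightarrow> real^'m^'m) \<Rightarrow> ('k \<Rightarrow> real) \<Rightarrow>
    real^'k \<Rightarrow> real^'n^'m" where
  "K_star M x0 A B Q0 R0 Q R c l = (THE K. is_minimizer M x0 A B Q0 R0 Q R c l K)"

definition nonneg_orthant :: "(real^'k) set" where
  "nonneg_orthant = {l. \<forall>i. 0 \<le> l $ i}"

end

theory Submission
  imports Defs "HOL-Computational_Algebra.Fundamental_Theorem_Algebra"
begin

text \<open>Let P solve the Riccati equation for the weights \<open>Q\<^sub>\<lambda>\<close>, \<open>R\<^sub>\<lambda>\<close>, with gain \<open>K\<^sup>*\<close>; it is the limit of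
  value iteration, bounded by controllability. Completing the square along the trajectories of a
  stabilizing K shows that the Lagrangian exceeds its value at \<open>K\<^sup>*\<close> by at least
  \<open>r \<parallel>K - K\<^sup>*\<parallel>\<^sup>2\<close>, where \<open>r > 0\<close> is a lower bound of \<open>R\<^sub>0\<close> and hence does not depend on \<open>\<lambda>\<close>. This
  gives existence and uniqueness of the minimizer. Comparing the quadratic growth at \<open>\<lambda>\<close> with
  minimality at a nearby \<open>\<lambda>'\<close> yields its continuity, and continuity of the costs on the
  stabilizing set gives the rest.\<close>

section \<open>Powers of a matrix and its spectral radius\<close>

text \<open>Membership in the stabilizing set is a condition on complex eigenvalues, whereas the
  costs need summable real trajectories and the optimal gain is first seen only to have vanishing
  ones. Summability is derived from a nonzero polynomial that annihilates the matrix, peeled off one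
  linear factor at a time; the converse follows an eigenvector. The second moment
  \<open>mat 1\<close> turns an expected cost into a sum over basis vectors as initial states. At
  time 0 the excess cost is then at least r times the squared length of a column of the gain
  difference, and all later terms are nonnegative; this is where the quadratic growth comes from.
  The stabilizing set is not compact, so nearby minimizers are not confined a priori. Instead,
  multiples of the positive definite \<open>Q0\<close> and \<open>R0\<close> dominate all other
  weights, which bounds the constrained costs at those minimizers. No continuity of the Riccati
  solution in \<lambda> enters.\<close>

primrec mpow :: "'a::comm_semiring_1^'n^'n \<Rightarrow> nat \<Rightarrow> 'a^'n^'n" where
  "mpow M 0 = mat 1"
| "mpow M (Suc k) = M ** mpow M k"

section \<open>Polynomials in a matrix, acting on vectors\<close>

definition poly_act :: "complex^'n^'n \<Rightarrow> complex poly \<Rightarrow> complex^'n \<Rightarrow> complex^'n" where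
  "poly_act G p v = fold_coeffs (\<lambda>a w. a *s v + G *v w) p 0"

lemma poly_act_0 [simp]: "poly_act G 0 v = 0"
  by (simp add: poly_act_def)

lemma poly_act_pCons [simp]: "poly_act G (pCons a p) v = a *s v + G *v poly_act G p v"
  by (cases "p = 0 \<and> a = 0") (auto simp: poly_act_def)

lemma poly_act_add_vec: "poly_act G p (v + w) = poly_act G p v + poly_act G p w"
  by (induction p) (simp_all add: vector_add_ldistrib matrix_vector_right_distrib)

lemma poly_act_scale_vec: "poly_act G p (a *s v) = a *s poly_act G p v"
  by (induction p) (simp_all add: vector_add_ldistrib matrix_vector_mult_scaleR vec.scale_left_commute vec.scale)

lemma poly_act_commute: "poly_act G p (G *v v) = G *v poly_act G p v"
  by (induction p) (simp_all add: matrix_vector_right_distrib vec.scale)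

lemma poly_act_add: "poly_act G (p + q) v = poly_act G p v + poly_act G q v"
proof (induction p q rule: poly_induct2)
  case (pCons a p b q)
  then show ?case by (simp add: matrix_vector_right_distrib vector_sadd_rdistrib algebra_simps)
qed simp

lemma poly_act_smult: "poly_act G (smult a p) v = a *s poly_act G p v"
  by (induction p) (simp_all add: vector_add_ldistrib vec.scale vector_smult_assoc)

text \<open>The factor G - m is split off on the outside, so that a nonzero q(G) v appears as an
  eigenvector for m. In \<open>poly_act_linear_factor'\<close> it is split off on the inside, which
  passes from v to (G - m) v instead.\<close>

lemma poly_act_linear_factor:
  "poly_act G ([:- m, 1:] * q) v = G *v poly_act G q v - m *s poly_act G q v"
proof -
  have "[:- m, 1:] * q = smult (- m) q + pCons 0 q"
    by simp
  then show ?thesis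
    by (simp only: poly_act_add poly_act_smult poly_act_pCons) simp
qed

lemma poly_act_linear_factor':
  "poly_act G ([:- m, 1:] * q) v = poly_act G q (G *v v - m *s v)"
proof -
  have "poly_act G q (G *v v + (- m) *s v) = poly_act G q (G *v v) + (- m) *s poly_act G q v"
    by (simp only: poly_act_add_vec poly_act_scale_vec)
  then show ?thesis
    unfolding poly_act_linear_factor by (simp add: poly_act_commute)
qed

lemma poly_act_eigenvector:
  assumes "G *v v = m *s v"
  shows "poly_act G p v = poly p m *s v"
  using assms by (induction p) (simp_all add: vec.scale vector_sadd_rdistrib vector_smult_assoc mult.commute)

lemma poly_act_monom: "poly_act G (monom a k) v = a *s (mpow G k *v v)"
  by (induction k) (simp_all add: monom_0 monom_Suc vec.scale matrix_vector_mul_assoc)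

text \<open>Powers of a matrix may coincide, so dependence is needed for an indexed family and not
  for its set of values; a repetition is itself a relation, with coefficients 1 and -1.\<close>

lemma linear_dependence_DIM:
  fixes f :: "nat \<Rightarrow> 'a::euclidean_space"
  shows "\<exists>c. (\<exists>i\<le>DIM('a). c i \<noteq> 0) \<and> (\<Sum>i\<le>DIM('a). c i *\<^sub>R f i) = 0"
proof (cases "inj_on f {..DIM('a)}")
  case True
  have "card (f ` {..DIM('a)}) = Suc DIM('a)"
    using True by (simp add: card_image)
  then have "dependent (f ` {..DIM('a)})"
    using independent_bound[of "f ` {..DIM('a)}"] by auto
  then obtain u where u: "\<exists>v\<in>f ` {..DIM('a)}. u v \<noteq> 0" "(\<Sum>v\<in>f ` {..DIM('a)}. u v *\<^sub>R v) = 0"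
    using dependent_finite[of "f ` {..DIM('a)}"] by auto
  then show ?thesis
    using True by (intro exI[of _ "u \<circ> f"]) (auto simp: sum.reindex)
next
  case False
  then obtain i j where ij: "i \<le> DIM('a)" "j \<le> DIM('a)" "i \<noteq> j" "f i = f j"
    by (auto simp: inj_on_def)
  define c :: "nat \<Rightarrow> real" where "c k = (if k = i then 1 else 0) - (if k = j then 1 else 0)" for k
  have "(\<Sum>k\<le>DIM('a). c k *\<^sub>R f k)
      = (\<Sum>k\<le>DIM('a). if k = i then f k else 0) - (\<Sum>k\<le>DIM('a). if k = j then f k else 0)"
    unfolding sum_subtractf[symmetric] by (intro sum.cong) (auto simp: c_def)
  also have "\<dots> = 0"
    using ij by simp
  finally show ?thesis
    using ij by (intro exI[of _ c]) (auto simp: c_def)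
qed

lemma sum_mat_vec: "(\<Sum>i\<in>I. H i) *v v = (\<Sum>i\<in>I. H i *v v)"
  by (induction I rule: infinite_finite_induct) (simp_all add: matrix_vector_mult_add_rdistrib)

text \<open>The matrices form a real vector space of finite dimension N, so the powers 0 to N are
  dependent, and the coefficients of a relation form p. Only that p is nonzero matters later, so p
  can stand in for the characteristic polynomial.\<close>

lemma exists_annihilating_poly:
  fixes G :: "complex^'n^'n"
  obtains p where "p \<noteq> 0" "\<And>v. poly_act G p v = 0"
proof -
  define N where "N = DIM(complex^'n^'n)"
  obtain c where c: "\<exists>i\<le>N. c i \<noteq> 0" "(\<Sum>i\<le>N. c i *\<^sub>R mpow G i) = 0"
    using linear_dependence_DIM[of "mpow G"] unfolding N_def by auto
  define p where "p = (\<Sum>i\<le>N. monom (complex_of_real (c i)) i)"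
  have coeff: "coeff p i = (if i \<le> N then complex_of_real (c i) else 0)" for i
    by (simp add: p_def coeff_sum)
  have nz: "p \<noteq> 0"
    using c(1) coeff by (metis coeff_0 of_real_eq_0_iff)
  have ps: "poly_act G (\<Sum>i\<in>I. q i) v = (\<Sum>i\<in>I. poly_act G (q i) v)" if "finite I" for I :: "nat set" and q v
    using that by induction (simp_all add: poly_act_add)
  have "poly_act G p v = 0" for v
  proof -
    have "poly_act G p v = (\<Sum>i\<le>N. complex_of_real (c i) *s (mpow G i *v v))"
      unfolding p_def by (simp add: ps poly_act_monom)
    also have "\<dots> = (\<Sum>i\<le>N. c i *\<^sub>R mpow G i) *v v"
    proof -
      have "complex_of_real a *s (H *v v) = (a *\<^sub>R H) *v v" for a and H :: "complex^'n^'n"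
        by (simp add: vec_eq_iff matrix_vector_mult_def sum_distrib_left
            scaleR_conv_of_real[where 'a = complex] mult.assoc)
      then show ?thesis
        by (simp add: sum_mat_vec)
    qed
    finally show ?thesis
      by (simp add: c(2))
  qed
  with nz show thesis
    by (rule that)
qed

lemma poly_linear_factor:
  fixes p :: "complex poly"
  assumes "degree p > 0"
  obtains m q where "p = [:- m, 1:] * q" "q \<noteq> 0" "degree q < degree p"
proof -
  have "\<not> constant (poly p)"
    using assms by (simp add: constant_degree)
  then obtain m where "poly p m = 0"
    using fundamental_theorem_of_algebra by blast
  then obtain q where q: "p = [:- m, 1:] * q"
    by (auto simp: poly_eq_0_iff_dvd dvd_def)
  moreover have "q \<noteq> 0"
    using assms q by auto
  moreover have "degree q < degree p"
    using \<open>q \<noteq> 0\<close> unfolding q by (subst degree_mult_eq) auto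
  ultimately show thesis
    by (rule that)
qed

text \<open>Split off a root m of p. Either q(G) v is zero and q, of smaller degree, still
  annihilates v, or q(G) v is an eigenvector for m.\<close>

lemma eigenvector_of_annihilated:
  assumes "p \<noteq> 0" "poly_act G p v = 0" "v \<noteq> 0"
  shows "\<exists>m w. w \<noteq> 0 \<and> G *v w = m *s w"
  using assms
proof (induction "degree p" arbitrary: p rule: less_induct)
  case less
  show ?case
  proof (cases "degree p = 0")
    case True
    then obtain a where "p = [:a:]"
      by (auto elim: degree_eq_zeroE)
    then show ?thesis
      using less.prems by simp
  next
    case False
    then obtain m q where q: "p = [:- m, 1:] * q" "q \<noteq> 0" "degree q < degree p"
      using poly_linear_factor by blast
    show ?thesis
    proof (cases "poly_act G q v = 0")
      case True
      then show ?thesis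
        using less.hyps[OF q(3) q(2)] less.prems by blast
    next
      case False
      moreover have "G *v poly_act G q v = m *s poly_act G q v"
        using less.prems(2) unfolding q(1) poly_act_linear_factor by simp
      ultimately show ?thesis
        by blast
    qed
  qed
qed

text \<open>Summing the triangle inequality over t < T bounds the partial sum S by |x 0| + |m| S +
  W, and |m| < 1 lets S be absorbed on the left.\<close>

lemma summable_norm_affine_recursion:
  fixes x w :: "nat \<Rightarrow> complex^'n"
  assumes rec: "\<And>t. x (Suc t) = m *s x t + w t" and m: "cmod m < 1"
    and w: "summable (\<lambda>t. norm (w t))"
  shows "summable (\<lambda>t. norm (x t))"
proof (rule summableI_nonneg_bounded)
  fix T
  let ?S = "\<Sum>t<T. norm (x t)" and ?W = "\<Sum>t. norm (w t)"
  have step: "norm (x (Suc t)) \<le> cmod m * norm (x t) + norm (w t)" for t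
  proof -
    have "norm (m *s x t) = cmod m * norm (x t)"
      by (simp add: norm_vec_def norm_mult L2_set_right_distrib)
    then show ?thesis
      unfolding rec using norm_triangle_ineq[of "m *s x t" "w t"] by simp
  qed
  have "?S \<le> (\<Sum>t<Suc T. norm (x t))"
    by simp
  also have "\<dots> = norm (x 0) + (\<Sum>t<T. norm (x (Suc t)))"
    by (rule sum.lessThan_Suc_shift)
  also have "\<dots> \<le> norm (x 0) + (cmod m * ?S + (\<Sum>t<T. norm (w t)))"
    using sum_mono[of "{..<T}" "\<lambda>t. norm (x (Suc t))" "\<lambda>t. cmod m * norm (x t) + norm (w t)"] step
    by (simp add: sum.distrib sum_distrib_left)
  also have "(\<Sum>t<T. norm (w t)) \<le> ?W"
    using w by (intro sum_le_suminf) auto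
  finally have "(1 - cmod m) * ?S \<le> norm (x 0) + ?W"
    by (simp add: algebra_simps)
  then show "?S \<le> (norm (x 0) + ?W) / (1 - cmod m)"
    using m by (simp add: field_simps)
qed simp

lemma summable_powers_of_annihilated:
  assumes ev: "\<And>m w. w \<noteq> 0 \<Longrightarrow> G *v w = m *s w \<Longrightarrow> cmod m < 1"
    and "p \<noteq> 0" "poly_act G p v = 0"
  shows "summable (\<lambda>t. norm (mpow G t *v v))"
  using assms(2,3)
proof (induction "degree p" arbitrary: p v rule: less_induct)
  case less
  show ?case
  proof (cases "degree p = 0")
    case True
    then obtain a where "p = [:a:]"
      by (auto elim: degree_eq_zeroE)
    then have "v = 0"
      using less.prems by simp
    then show ?thesis by simp
  next
    case False
    then obtain m q where q: "p = [:- m, 1:] * q" "q \<noteq> 0" "degree q < degree p"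
      using poly_linear_factor by blast
    show ?thesis
    proof (cases "cmod m < 1")
      case True
      let ?w = "G *v v - m *s v"
      have w: "summable (\<lambda>t. norm (mpow G t *v ?w))"
        using less.hyps[OF q(3) q(2)] less.prems(2) unfolding q(1) poly_act_linear_factor' by blast
      have rec: "mpow G (Suc t) *v v = m *s (mpow G t *v v) + mpow G t *v ?w" for t
      proof -
        have "mpow G (Suc t) *v v = mpow G t *v (G *v v)"
          by (induction t) (simp_all add: matrix_vector_mul_assoc[symmetric])
        then show ?thesis
          by (simp add: matrix_vector_mult_diff_distrib vec.scale)
      qed
      show ?thesis
        using rec True w by (rule summable_norm_affine_recursion)
    next
      case False
      have "G *v poly_act G q v = m *s poly_act G q v"
        using less.prems(2) unfolding q(1) poly_act_linear_factor by simp
      then have "poly_act G q v = 0"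
        using ev False by blast
      then show ?thesis
        using less.hyps[OF q(3) q(2)] by blast
    qed
  qed
qed

section \<open>Complex eigenvalues of a real matrix and decay of its powers\<close>

definition cmat :: "real^'n^'m \<Rightarrow> complex^'n^'m" where
  "cmat M = (\<chi> i j. complex_of_real (M $ i $ j))"

definition cvec :: "real^'n \<Rightarrow> complex^'n" where
  "cvec x = (\<chi> i. complex_of_real (x $ i))"

lemma cmat_mult_cvec: "cmat M *v cvec x = cvec (M *v x)"
  by (simp add: cmat_def cvec_def matrix_vector_mult_def vec_eq_iff)

lemma mpow_cmat_cvec: "mpow (cmat M) t *v cvec x = cvec (mpow M t *v x)"
  by (induction t) (simp_all add: matrix_vector_mul_assoc[symmetric] cmat_mult_cvec)

lemma norm_cvec: "norm (cvec x) = norm x"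
  by (simp add: cvec_def norm_vec_def)

lemma spectrum_cmat: "spectrum M = {m. \<exists>v. v \<noteq> 0 \<and> cmat M *v v = m *s v}"
  by (simp add: spectrum_def cmat_def)

lemma spectrumE:
  fixes M :: "real^'n^'n"
  assumes "m \<in> spectrum M"
  obtains v where "v \<noteq> 0" "cmat M *v v = m *s v"
proof -
  have "\<exists>v. v \<noteq> 0 \<and> cmat M *v v = m *s v"
    using assms[unfolded spectrum_cmat] unfolding mem_Collect_eq .
  then show thesis
    by (elim exE conjE) (rule that)
qed

lemma spectrum_finite:
  fixes M :: "real^'n^'n"
  shows "finite (spectrum M)"
proof -
  obtain p where p: "p \<noteq> 0" "\<And>v. poly_act (cmat M) p v = 0"
    using exists_annihilating_poly by blast
  have "poly p m = 0" if "m \<in> spectrum M" for m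
  proof -
    obtain v where v: "v \<noteq> 0" "cmat M *v v = m *s v"
      using \<open>m \<in> spectrum M\<close> by (rule spectrumE)
    then have "poly p m *s v = 0"
      using p(2)[of v] poly_act_eigenvector[of "cmat M" v m p] by simp
    then show ?thesis
      using v(1) by simp
  qed
  then have "spectrum M \<subseteq> {m. poly p m = 0}"
    by blast
  then show ?thesis
    using poly_roots_finite[OF p(1)] by (rule finite_subset)
qed

lemma spectrum_nonempty:
  fixes M :: "real^'n^'n"
  shows "spectrum M \<noteq> {}"
proof -
  obtain p where p: "p \<noteq> 0" "\<And>v. poly_act (cmat M) p v = 0"
    using exists_annihilating_poly by blast
  \<comment> \<open>The all-ones vector serves as the nonzero vector to start from.\<close>
  have "(1 :: complex^'n) \<noteq> 0"
    by (simp add: vec_eq_iff)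
  then obtain m w where "w \<noteq> 0" "cmat M *v w = m *s w"
    using eigenvector_of_annihilated[OF p(1) p(2)[of 1]] by blast
  then have "m \<in> spectrum M"
    unfolding spectrum_cmat mem_Collect_eq by (intro exI conjI)
  then show ?thesis
    by blast
qed

text \<open>\<open>Max\<close> characterizes a bound only on a finite nonempty set, which is what
  the two preceding lemmas supply.\<close>

lemma spectral_radius_less_iff: "spectral_radius M < r \<longleftrightarrow> (\<forall>m\<in>spectrum M. cmod m < r)"
proof -
  have "finite (cmod ` spectrum M)" "cmod ` spectrum M \<noteq> {}"
    using spectrum_finite[of M] spectrum_nonempty[of M] by simp_all
  from Max_less_iff[OF this, of r] show ?thesis
    unfolding spectral_radius_def by blast
qed

lemma summable_norm_powers:
  fixes M :: "real^'n^'n"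
  assumes "spectral_radius M < 1"
  shows "summable (\<lambda>t. norm (mpow M t *v x))"
proof -
  obtain p where p: "p \<noteq> 0" "\<And>v. poly_act (cmat M) p v = 0"
    using exists_annihilating_poly by blast
  have "summable (\<lambda>t. norm (mpow (cmat M) t *v cvec x))"
  proof (rule summable_powers_of_annihilated[OF _ p(1) p(2)])
    fix m and w :: "complex^'n"
    assume "w \<noteq> 0" "cmat M *v w = m *s w"
    then have "m \<in> spectrum M"
      unfolding spectrum_cmat mem_Collect_eq by (intro exI conjI)
    then show "cmod m < 1"
      using assms unfolding spectral_radius_less_iff by blast
  qed
  then show ?thesis
    by (simp add: mpow_cmat_cvec norm_cvec)
qed

text \<open>Write a complex eigenvector as v = a + i b with a, b real. Then m^t v is the t-th power
  applied to v, bounded by the real orbits of a and b, so |m|^t |v| tends to 0.\<close>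

lemma spectral_radius_less_1I:
  fixes M :: "real^'n^'n"
  assumes "\<And>x. (\<lambda>t. mpow M t *v x) \<longlonglongrightarrow> 0"
  shows "spectral_radius M < 1"
  unfolding spectral_radius_less_iff
proof
  fix m assume "m \<in> spectrum M"
  then obtain v where v: "v \<noteq> 0" "cmat M *v v = m *s v"
    by (rule spectrumE)
  define a b :: "real^'n" where "a = (\<chi> i. Re (v $ i))" and "b = (\<chi> i. Im (v $ i))"
  have vab: "v = cvec a + \<i> *s cvec b"
    by (simp add: vec_eq_iff cvec_def a_def b_def complex_eq_iff)
  have pow: "mpow (cmat M) t *v v = m ^ t *s v" for t
    by (induction t) (simp_all add: matrix_vector_mul_assoc[symmetric] vec.scale v vector_smult_assoc mult.commute)
  have bound: "norm (m ^ t *s v) \<le> norm (mpow M t *v a) + norm (mpow M t *v b)" for t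
  proof -
    have "m ^ t *s v = cvec (mpow M t *v a) + \<i> *s cvec (mpow M t *v b)"
      unfolding pow[symmetric] by (simp add: vab matrix_vector_right_distrib vec.scale mpow_cmat_cvec)
    moreover have "norm (\<i> *s cvec (mpow M t *v b)) = norm (mpow M t *v b)"
      by (simp add: norm_vec_def norm_mult cvec_def)
    ultimately show ?thesis
      using norm_triangle_ineq[of "cvec (mpow M t *v a)" "\<i> *s cvec (mpow M t *v b)"]
      by (simp add: norm_cvec)
  qed
  have "(\<lambda>t. norm (mpow M t *v a) + norm (mpow M t *v b)) \<longlonglongrightarrow> 0"
    using tendsto_add[OF tendsto_norm_zero[OF assms[of a]] tendsto_norm_zero[OF assms[of b]]] by simp
  then have "(\<lambda>t. norm (m ^ t *s v)) \<longlonglongrightarrow> 0"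
    by (rule real_tendsto_sandwich[OF always_eventually always_eventually tendsto_const, rotated 2])
      (simp_all add: bound)
  then have lim: "(\<lambda>t. cmod m ^ t * norm v) \<longlonglongrightarrow> 0"
    by (simp add: norm_vec_def norm_mult norm_power L2_set_right_distrib)
  show "cmod m < 1"
  proof (rule ccontr)
    assume "\<not> cmod m < 1"
    then have "norm v \<le> cmod m ^ t * norm v" for t
      using one_le_power[of "cmod m" t] mult_right_mono[of 1 "cmod m ^ t" "norm v"] by simp
    then have "norm v \<le> 0"
      by (intro LIMSEQ_le_const[OF lim]) auto
    then show False
      using v(1) by simp
  qed
qed

section \<open>Quadratic forms and the Riccati equation\<close>

definition qf :: "real^'n^'n \<Rightarrow> real^'n \<Rightarrow> real" where
  "qf M x = x \<bullet> (M *v x)"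

lemma stage_cost_qf: "stage_cost Q R x u = qf Q x + qf R u"
  by (simp add: stage_cost_def qf_def)

declare transpose_matrix_vector [simp del]

text \<open>The adjoint rule. It presupposes that \<open>transpose G *v z\<close> is left as it
  stands, which is why the rewriting of such terms to \<open>v*\<close> was just removed from the
  simpset.\<close>

lemma inner_transpose: "x \<bullet> (transpose G *v z) = (G *v x) \<bullet> z"
  for G :: "real^'n^'m"
  by (metis dot_lmul_matrix inner_commute transpose_matrix_vector transpose_transpose)

lemma qf_zero [simp]: "qf M 0 = 0" "qf 0 x = 0"
  by (simp_all add: qf_def)

lemma matrix_vector_mult_minus_right: "M *v (- x) = - (M *v x)"
  for M :: "real^'n^'m"
  by (simp add: matrix_vector_mult_def vec_eq_iff sum_negf)

lemma qf_minus [simp]: "qf M (- x) = qf M x"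
  by (simp add: qf_def matrix_vector_mult_minus_right)

lemma qf_add_matrix: "qf (M + N) x = qf M x + qf N x"
  by (simp add: qf_def matrix_vector_mult_add_rdistrib inner_add_right)

lemma qf_diff_matrix: "qf (M - N) x = qf M x - qf N x"
  by (simp add: qf_def matrix_vector_mult_diff_rdistrib inner_diff_right)

lemma qf_scaleR_matrix: "qf (a *\<^sub>R M) x = a * qf M x"
  by (simp add: qf_def scaleR_matrix_vector_assoc[symmetric])

lemma qf_sum_matrix: "qf (\<Sum>i\<in>I. M i) x = (\<Sum>i\<in>I. qf (M i) x)"
  by (induction I rule: infinite_finite_induct) (simp_all add: qf_add_matrix)

lemma qf_congruence: "qf (transpose G ** P ** G) x = qf P (G *v x)"
  for G :: "real^'n^'m"
  by (simp add: qf_def matrix_vector_mul_assoc[symmetric] inner_transpose)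

lemma symmetric_inner:
  fixes M :: "real^'n^'n"
  assumes "transpose M = M"
  shows "x \<bullet> (M *v y) = y \<bullet> (M *v x)"
  by (metis assms inner_commute inner_transpose)

lemma qf_add:
  assumes "transpose M = M"
  shows "qf M (x + y) = qf M x + qf M y + 2 * (x \<bullet> (M *v y))"
  using symmetric_inner[OF assms, of x y]
  by (simp add: qf_def matrix_vector_right_distrib inner_add_left inner_add_right)

text \<open>The norm of a matrix is here the Frobenius norm, so Cauchy-Schwarz applies row by
  row.\<close>

lemma norm_matrix_vector_le: "norm (M *v x) \<le> norm M * norm x"
  for M :: "real^'n^'m"
proof -
  have "norm (M *v x) \<le> L2_set (\<lambda>i. norm (M $ i) * norm x) UNIV"
    unfolding norm_vec_def[of "M *v x"]
    by (intro L2_set_mono) (simp_all add: matrix_vector_mul_component Cauchy_Schwarz_ineq2)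
  also have "\<dots> = norm M * norm x"
    unfolding norm_vec_def[of M] by (simp add: L2_set_left_distrib)
  finally show ?thesis .
qed

lemma abs_qf_le: "\<bar>qf M x\<bar> \<le> norm M * (norm x)\<^sup>2"
proof -
  have "\<bar>qf M x\<bar> \<le> norm x * norm (M *v x)"
    unfolding qf_def by (rule Cauchy_Schwarz_ineq2)
  also have "\<dots> \<le> norm x * (norm M * norm x)"
    by (intro mult_left_mono norm_matrix_vector_le) simp
  finally show ?thesis
    by (simp add: power2_eq_square mult_ac)
qed

lemma bounded_bilinear_matrix_vector: "bounded_bilinear ((*v) :: real^'n^'m \<Rightarrow> real^'n \<Rightarrow> real^'m)"
proof
  show "\<exists>K. \<forall>(M :: real^'n^'m) x. norm (M *v x) \<le> norm M * norm x * K"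
    using norm_matrix_vector_le by (intro exI[of _ 1]) auto
qed (simp_all add: matrix_vector_mult_add_rdistrib matrix_vector_right_distrib
    scaleR_matrix_vector_assoc matrix_vector_mult_scaleR)

lemmas tendsto_matrix_vector [tendsto_intros] =
  bounded_bilinear.tendsto[OF bounded_bilinear_matrix_vector]

lemma tendsto_matrix_matrix [tendsto_intros]:
  fixes f :: "'a \<Rightarrow> real^'n^'m" and g :: "'a \<Rightarrow> real^'k^'n"
  assumes "(f \<longlongrightarrow> M) F" "(g \<longlongrightarrow> N) F"
  shows "((\<lambda>x. f x ** g x) \<longlongrightarrow> M ** N) F"
  unfolding matrix_matrix_mult_def
  by (intro vec_tendstoI) (auto intro!: tendsto_intros tendsto_vec_nth assms)

lemma tendsto_transpose [tendsto_intros]: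
  fixes f :: "'a \<Rightarrow> real^'n^'m"
  assumes "(f \<longlongrightarrow> M) F"
  shows "((\<lambda>x. transpose (f x)) \<longlongrightarrow> transpose M) F"
  unfolding transpose_def
  by (intro vec_tendstoI) (auto intro!: tendsto_intros tendsto_vec_nth assms)

lemma tendsto_qf [tendsto_intros]:
  assumes "(f \<longlongrightarrow> M) F" "(g \<longlongrightarrow> x) F"
  shows "((\<lambda>k. qf (f k) (g k)) \<longlongrightarrow> qf M x) F"
  unfolding qf_def by (intro tendsto_intros assms)

text \<open>The constant is the minimum of the form on the compact unit sphere; homogeneity of
  degree 2 extends it to all x.\<close>

lemma pos_def_lower_bound:
  fixes M :: "real^'n^'n"
  assumes "pos_def M"
  obtains r where "r > 0" "\<And>x. r * (norm x)\<^sup>2 \<le> qf M x"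
proof -
  have "continuous_on (sphere 0 1) (qf M)"
    unfolding continuous_on_def by (intro ballI tendsto_intros)
  moreover have "(axis undefined 1 :: real^'n) \<in> sphere 0 1"
    by simp
  then have "sphere (0 :: real^'n) 1 \<noteq> {}"
    by blast
  ultimately obtain y where y: "y \<in> sphere 0 1" "\<And>x. x \<in> sphere 0 1 \<Longrightarrow> qf M y \<le> qf M x"
    using continuous_attains_inf[of "sphere (0 :: real^'n) 1" "qf M"] by auto
  have "y \<noteq> 0"
    using y(1) by auto
  then have "qf M y > 0"
    using assms by (simp add: pos_def_def qf_def)
  moreover have "qf M y * (norm x)\<^sup>2 \<le> qf M x" for x
  proof (cases "x = 0")
    case False
    have "qf M y \<le> qf M ((1 / norm x) *\<^sub>R x)"
      using False by (intro y(2)) simp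
    also have "\<dots> = qf M x / (norm x)\<^sup>2"
      by (simp add: qf_def matrix_vector_mult_scaleR power2_eq_square)
    finally show ?thesis
      using False by (simp add: field_simps)
  qed simp
  ultimately show thesis
    by (rule that)
qed

section \<open>Semidefinite matrices and their limits\<close>

lemma pos_semidef_nonneg: "pos_semidef M \<Longrightarrow> 0 \<le> qf M x"
  by (simp add: pos_semidef_def qf_def)

lemma pos_semidef_symmetric: "pos_semidef M \<Longrightarrow> transpose M = M"
  by (simp add: pos_semidef_def)

lemma pos_def_imp_pos_semidef: "pos_def M \<Longrightarrow> pos_semidef M"
  unfolding pos_def_def pos_semidef_def by (metis inner_zero_left less_eq_real_def)

lemma transpose_add: "transpose (M + N) = transpose M + transpose N"
  for M :: "'a::semiring_1^'n^'m"
  by (simp add: transpose_def vec_eq_iff)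

lemma pos_semidefI: "transpose M = M \<Longrightarrow> (\<And>x. 0 \<le> qf M x) \<Longrightarrow> pos_semidef M"
  by (simp add: pos_semidef_def qf_def)

lemma pos_semidef_zero: "pos_semidef 0"
  by (intro pos_semidefI) (simp_all add: transpose_def vec_eq_iff)

lemma pos_semidef_add: "pos_semidef M \<Longrightarrow> pos_semidef N \<Longrightarrow> pos_semidef (M + N)"
  by (intro pos_semidefI)
    (simp_all add: transpose_add pos_semidef_symmetric qf_add_matrix pos_semidef_nonneg)

lemma pos_semidef_scaleR: "pos_semidef M \<Longrightarrow> 0 \<le> a \<Longrightarrow> pos_semidef (a *\<^sub>R M)"
  by (intro pos_semidefI)
    (simp_all add: transpose_scalar pos_semidef_symmetric qf_scaleR_matrix pos_semidef_nonneg)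

lemma pos_semidef_sum: "(\<And>i. i \<in> I \<Longrightarrow> pos_semidef (M i)) \<Longrightarrow> pos_semidef (\<Sum>i\<in>I. M i)"
  by (induction I rule: infinite_finite_induct) (simp_all add: pos_semidef_zero pos_semidef_add)

lemma pos_semidef_congruence:
  fixes G :: "real^'n^'m"
  assumes "pos_semidef P"
  shows "pos_semidef (transpose G ** P ** G)"
  using assms by (intro pos_semidefI)
    (simp_all add: matrix_transpose_mul matrix_mul_assoc pos_semidef_symmetric qf_congruence pos_semidef_nonneg)

lemma pos_def_add: "pos_def M \<Longrightarrow> pos_semidef N \<Longrightarrow> pos_def (M + N)"
  unfolding pos_def_def pos_semidef_def
  by (simp add: transpose_add matrix_vector_mult_add_rdistrib inner_add_right add_pos_nonneg)

lemma pos_def_invertible: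
  fixes M :: "real^'n^'n"
  assumes "pos_def M"
  shows "invertible M"
proof -
  have "\<forall>x. M *v x = 0 \<longrightarrow> x = 0"
    using assms unfolding pos_def_def by (metis inner_zero_right less_irrefl)
  then show ?thesis
    unfolding invertible_left_inverse matrix_left_invertible_ker .
qed

text \<open>By polarization, the entries of a symmetric matrix are combinations of values of its
  quadratic form.\<close>

lemma symmetric_matrix_convergent:
  fixes P :: "nat \<Rightarrow> real^'n^'n"
  assumes sym: "\<And>k. transpose (P k) = P k"
    and conv: "\<And>x. convergent (\<lambda>k. qf (P k) x)"
  obtains L where "P \<longlonglongrightarrow> L"
proof -
  have entry: "P k $ i $ j = (qf (P k) (axis i 1 + axis j 1) - qf (P k) (axis i 1) - qf (P k) (axis j 1)) / 2"
    for k i j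
    using qf_add[OF sym[of k], of "axis i 1" "axis j 1"]
    by (simp add: inner_axis' matrix_vector_mul_component inner_axis)
  have "\<exists>l. (\<lambda>k. P k $ i $ j) \<longlonglongrightarrow> l" for i j
    unfolding entry divide_inverse convergent_def[symmetric]
    by (intro convergent_diff conv convergent_mult convergent_const)
  then obtain l where "\<And>i j. (\<lambda>k. P k $ i $ j) \<longlonglongrightarrow> l i j"
    by metis
  then have "P \<longlonglongrightarrow> (\<chi> i j. l i j)"
    by (intro vec_tendstoI) simp
  then show thesis
    by (rule that)
qed

lemma pos_semidef_tendsto:
  fixes P :: "nat \<Rightarrow> real^'n^'n"
  assumes "P \<longlonglongrightarrow> L" "\<And>k. pos_semidef (P k)"
  shows "pos_semidef L"
proof (rule pos_semidefI)
  have "(\<lambda>k. transpose (P k)) \<longlonglongrightarrow> transpose L"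
    by (intro tendsto_intros assms)
  then show "transpose L = L"
    using assms LIMSEQ_unique by (simp add: pos_semidef_symmetric)
  show "0 \<le> qf L x" for x
    using tendsto_qf[OF assms(1) tendsto_const[of x]] assms(2) pos_semidef_nonneg
    by (intro LIMSEQ_le_const) blast+
qed

lemma incseq_bounded_convergent:
  fixes f :: "nat \<Rightarrow> real"
  assumes "\<And>k. f k \<le> f (Suc k)" "\<And>k. f k \<le> C"
  shows "convergent f"
proof -
  have "incseq f"
    using assms(1) by (rule incseq_SucI)
  then show ?thesis
    using incseq_convergent[of f C] assms(2) unfolding convergent_def by metis
qed

section \<open>The Riccati step and value iteration for fixed weights\<close>

locale lqr =
  fixes A :: "real^'n^'n" and B :: "real^'m^'n" and Q :: "real^'n^'n" and R :: "real^'m^'m"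
  assumes Q: "pos_def Q" and R: "pos_def R"
begin

definition gain :: "real^'n^'n \<Rightarrow> real^'n^'m" where
  "gain P = matrix_inv (R + transpose B ** P ** B) ** (transpose B ** P ** A)"

text \<open>This is the Joseph form, the one-step cost under \<open>gain P\<close>. For semidefinite
  P it equals Q + A^T P A - A^T P B (R + B^T P B)^{-1} B^T P A, but it makes semidefiniteness
  evident.\<close>

definition riccati :: "real^'n^'n \<Rightarrow> real^'n^'n" where
  "riccati P = Q + transpose (gain P) ** R ** gain P
     + transpose (A - B ** gain P) ** P ** (A - B ** gain P)"

lemma qf_riccati:
  "qf (riccati P) x = qf Q x + qf R (gain P *v x) + qf P (A *v x - B *v (gain P *v x))"
  by (simp add: riccati_def qf_add_matrix qf_congruence matrix_vector_mult_diff_rdistrib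
      matrix_vector_mul_assoc)

lemma pos_semidef_riccati: "pos_semidef P \<Longrightarrow> pos_semidef (riccati P)"
  unfolding riccati_def
  using pos_def_imp_pos_semidef[OF Q] pos_def_imp_pos_semidef[OF R]
  by (intro pos_semidef_add pos_semidef_congruence)

text \<open>These are the normal equations (R + B^T P B) k = B^T P A x of the one-step minimization.
  Only here is the inverse inside \<open>gain\<close> opened; later arguments rest on the
  equations.\<close>

lemma gain_equation:
  assumes "pos_semidef P"
  shows "R *v (gain P *v x) + transpose B *v (P *v (B *v (gain P *v x)))
    = transpose B *v (P *v (A *v x))"
proof -
  let ?S = "R + transpose B ** P ** B"
  have "invertible ?S"
    by (intro pos_def_invertible pos_def_add R pos_semidef_congruence assms)
  then have inv: "?S ** matrix_inv ?S = mat 1"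
    unfolding invertible_def matrix_inv_def by (rule someI2_ex) blast
  have "?S ** gain P = (?S ** matrix_inv ?S) ** (transpose B ** P ** A)"
    unfolding gain_def by (simp only: matrix_mul_assoc)
  then have "?S ** gain P = transpose B ** P ** A"
    unfolding inv by simp
  then have "(?S ** gain P) *v x = (transpose B ** P ** A) *v x"
    by simp
  then show ?thesis
    by (simp add: matrix_vector_mul_assoc[symmetric] matrix_vector_mult_add_rdistrib)
qed

lemma completion_of_squares:
  assumes "pos_semidef P"
  defines "v \<equiv> \<lambda>x u. u + gain P *v x"
  shows "qf Q x + qf R u + qf P (A *v x + B *v u)
    = qf (riccati P) x + qf R (v x u) + qf P (B *v v x u)"
proof -
  let ?k = "gain P *v x" and ?v = "v x u"
  let ?y = "A *v x - B *v ?k"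
  have "qf R u = qf R (?v + - ?k)"
    by (simp add: v_def)
  also have "\<dots> = qf R ?v + qf R ?k - 2 * (?v \<bullet> (R *v ?k))"
    using R by (subst qf_add) (simp_all add: pos_def_def matrix_vector_mult_minus_right)
  finally have 1: "qf R u = qf R ?v + qf R ?k - 2 * (?v \<bullet> (R *v ?k))" .
  have "A *v x + B *v u = B *v ?v + ?y"
    by (simp add: v_def matrix_vector_right_distrib)
  then have 2: "qf P (A *v x + B *v u) = qf P (B *v ?v) + qf P ?y + 2 * ((B *v ?v) \<bullet> (P *v ?y))"
    by (simp only: qf_add[OF pos_semidef_symmetric[OF assms(1)]])
  have "(B *v ?v) \<bullet> (P *v ?y) = ?v \<bullet> (transpose B *v (P *v ?y))"
    by (simp add: inner_transpose)
  \<comment> \<open>By the normal equations the two cross terms, which carry opposite signs, agree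
    and cancel.\<close>
  also have "transpose B *v (P *v ?y) = R *v ?k"
    using gain_equation[OF assms(1), of x]
    by (simp add: matrix_vector_mult_diff_distrib algebra_simps)
  finally show ?thesis
    using 1 2 by (simp add: qf_riccati)
qed

text \<open>The two squares of the deviation v are nonnegative. Together with
  \<open>qf_riccati_attained\<close> this makes \<open>riccati\<close> the Bellman operator, a
  minimum over u.\<close>

lemma qf_riccati_le:
  assumes "pos_semidef P"
  shows "qf (riccati P) x \<le> qf Q x + qf R u + qf P (A *v x + B *v u)"
  unfolding completion_of_squares[OF assms]
  using assms R by (simp add: pos_semidef_nonneg pos_def_imp_pos_semidef)

lemma qf_riccati_attained:
  "qf (riccati P) x = qf Q x + qf R (- (gain P *v x)) + qf P (A *v x + B *v (- (gain P *v x)))"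
  by (simp add: qf_riccati matrix_vector_mult_minus_right)

text \<open>Continuity of the matrix inverse is bypassed. The limiting gain violates the normal
  equations for \<open>P k\<close> only by a defect \<open>d (P k)\<close> that tends to 0, and R +
  B^T (P k) B is bounded below by r uniformly in k, so the gains applied to x differ by at most the
  defect over r.\<close>

lemma gain_tendsto:
  fixes P :: "nat \<Rightarrow> real^'n^'n"
  assumes "P \<longlonglongrightarrow> L" "\<And>k. pos_semidef (P k)"
  shows "(\<lambda>k. gain (P k) *v x) \<longlonglongrightarrow> gain L *v x"
proof -
  obtain r where r: "r > 0" "\<And>v. r * (norm v)\<^sup>2 \<le> qf R v"
    using pos_def_lower_bound[OF R] by blast
  let ?k = "gain L *v x"
  define d where "d P = transpose B *v (P *v (A *v x)) - (R *v ?k + transpose B *v (P *v (B *v ?k)))"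
    for P
  have "(\<lambda>k. d (P k)) \<longlonglongrightarrow> d L"
    unfolding d_def by (intro tendsto_intros assms)
  moreover have "d L = 0"
    unfolding d_def using gain_equation pos_semidef_tendsto[OF assms] by simp
  ultimately have lim: "(\<lambda>k. norm (d (P k)) / r) \<longlonglongrightarrow> 0"
    using tendsto_divide[OF tendsto_norm tendsto_const, of "\<lambda>k. d (P k)" 0 sequentially r] r by simp
  have bound: "norm (gain (P k) *v x - ?k) \<le> norm (d (P k)) / r" for k
  proof -
    let ?v = "gain (P k) *v x - ?k"
    have "r * (norm ?v)\<^sup>2 \<le> qf R ?v + qf (P k) (B *v ?v)"
      using r(2)[of ?v] pos_semidef_nonneg[OF assms(2)[of k], of "B *v ?v"] by linarith
    also have "\<dots> = ?v \<bullet> (R *v ?v + transpose B *v (P k *v (B *v ?v)))"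
      by (simp add: qf_def inner_add_right inner_transpose)
    also have "R *v ?v + transpose B *v (P k *v (B *v ?v)) = d (P k)"
      unfolding d_def gain_equation[OF assms(2), symmetric]
      by (simp add: matrix_vector_mult_diff_distrib)
    also have "?v \<bullet> d (P k) \<le> norm ?v * norm (d (P k))"
      by (rule norm_cauchy_schwarz)
    finally have "norm ?v * (r * norm ?v) \<le> norm ?v * norm (d (P k))"
      by (simp add: power2_eq_square mult_ac)
    then have "r * norm ?v \<le> norm (d (P k))"
      by (cases "?v = 0") simp_all
    then show ?thesis
      using r by (simp add: field_simps)
  qed
  have "(\<lambda>k. gain (P k) *v x - ?k) \<longlonglongrightarrow> 0"
    using lim by (rule Lim_null_comparison[rotated]) (simp add: bound)
  then show ?thesis
    by (simp add: LIM_zero_iff)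
qed

text \<open>Value iteration from zero increases, and it stays bounded because controllability gives a
  control of finite cost.\<close>

lemma riccati_fixed_point:
  assumes "controllable A B"
  obtains P where "pos_semidef P" "\<And>x. qf (riccati P) x = qf P x"
proof -
  define P where "P k = (riccati ^^ k) 0" for k
  have P0: "P 0 = 0" and PSuc: "P (Suc k) = riccati (P k)" for k
    by (simp_all add: P_def)
  have psd: "pos_semidef (P k)" for k
    by (induction k) (simp_all add: P0 PSuc pos_semidef_zero pos_semidef_riccati)
  have mono: "qf (P k) x \<le> qf (P (Suc k)) x" for k x
  proof (induction k arbitrary: x)
    case 0
    then show ?case
      using psd by (simp add: P0 pos_semidef_nonneg)
  next
    case (Suc k)
    \<comment> \<open>The input that is optimal for the longer horizon competes in the shorter
      one.\<close>
    let ?u = "- (gain (P (Suc k)) *v x)"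
    have "qf (P (Suc k)) x \<le> qf Q x + qf R ?u + qf (P k) (A *v x + B *v ?u)"
      unfolding PSuc by (rule qf_riccati_le[OF psd])
    also have "\<dots> \<le> qf Q x + qf R ?u + qf (P (Suc k)) (A *v x + B *v ?u)"
      using Suc.IH by simp
    also have "\<dots> = qf (P (Suc (Suc k))) x"
      unfolding PSuc[of "Suc k"] by (rule qf_riccati_attained[symmetric])
    finally show ?case .
  qed
  have "\<exists>C. \<forall>k. qf (P k) x \<le> C" for x
  proof -
    obtain u T where u: "trajectory A B u x T = 0"
      using assms unfolding controllable_def by blast
    \<comment> \<open>Backwards along a trajectory that reaches 0 at time T: the bound is 0 there,
      and each step back adds one stage cost.\<close>
    have "\<exists>C. \<forall>k. qf (P k) (trajectory A B u x t) \<le> C" if "t \<le> T" for t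
      using that
    proof (induction t rule: inc_induct)
      case base
      then show ?case
        by (intro exI[of _ 0]) (simp add: u)
    next
      case (step t)
      let ?x = "trajectory A B u x t"
      obtain C where C: "\<And>k. qf (P k) (A *v ?x + B *v u t) \<le> C"
        using step.IH by auto
      have "qf (P k) ?x \<le> qf Q ?x + qf R (u t) + C" for k
      proof -
        \<comment> \<open>Raising the index first allows a Riccati step to be opened for k = 0 too,
          and what remains concerns \<open>P k\<close> again.\<close>
        have "qf (P k) ?x \<le> qf (P (Suc k)) ?x"
          by (rule mono)
        also have "\<dots> \<le> qf Q ?x + qf R (u t) + qf (P k) (A *v ?x + B *v u t)"
          unfolding PSuc by (rule qf_riccati_le[OF psd])
        finally show ?thesis
          using C[of k] by linarith
      qed
      then show ?case
        by blast
    qed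
    from this[of 0] show ?thesis
      by simp
  qed
  then have "convergent (\<lambda>k. qf (P k) x)" for x
    using incseq_bounded_convergent[of "\<lambda>k. qf (P k) x"] mono by blast
  then obtain L where L: "P \<longlonglongrightarrow> L"
    using symmetric_matrix_convergent[of P] psd pos_semidef_symmetric by blast
  have "qf (riccati L) x = qf L x" for x
  proof (rule LIMSEQ_unique)
    define g where "g k = gain (P k) *v x" for k
    have "g \<longlonglongrightarrow> gain L *v x"
      unfolding g_def by (rule gain_tendsto[OF L psd])
    then show "(\<lambda>k. qf (P (Suc k)) x) \<longlonglongrightarrow> qf (riccati L) x"
      unfolding PSuc qf_riccati g_def[symmetric]
      by (intro tendsto_add tendsto_diff tendsto_qf tendsto_matrix_vector tendsto_const L)
    show "(\<lambda>k. qf (P (Suc k)) x) \<longlonglongrightarrow> qf L x"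
      by (intro LIMSEQ_Suc[of "\<lambda>k. qf (P k) x"] tendsto_qf tendsto_const L)
  qed
  with pos_semidef_tendsto[OF L psd] show thesis
    by (rule that)
qed

end

section \<open>Closed-loop costs\<close>

lemma closed_loop_Suc: "closed_loop A B K x (Suc t) = (A - B ** K) *v closed_loop A B K x t"
  by (simp add: matrix_vector_mult_diff_rdistrib matrix_vector_mul_assoc[symmetric]
      matrix_vector_mult_minus_right)

lemma closed_loop_mpow: "closed_loop A B K x t = mpow (A - B ** K) t *v x"
  by (induction t) (simp_all only: closed_loop_Suc closed_loop.simps(1) mpow.simps
      matrix_vector_mul_lid matrix_vector_mul_assoc)

lemma closed_loop_Suc_shift: "closed_loop A B K x (Suc t) = closed_loop A B K ((A - B ** K) *v x) t"
  by (induction t) (simp_all only: closed_loop_Suc closed_loop.simps(1))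

declare closed_loop.simps(2) [simp del]

text \<open>With u = -K x the stage cost is a single quadratic form in the state; this is its
  matrix.\<close>

definition weight :: "real^'n^'n \<Rightarrow> real^'m^'m \<Rightarrow> real^'n^'m \<Rightarrow> real^'n^'n" where
  "weight Q R K = Q + transpose K ** R ** K"

lemma qf_weight: "qf (weight Q R K) x = qf Q x + qf R (K *v x)"
  by (simp add: weight_def qf_add_matrix qf_congruence)

lemma pos_semidef_weight: "pos_semidef Q \<Longrightarrow> pos_semidef R \<Longrightarrow> pos_semidef (weight Q R K)"
  unfolding weight_def by (intro pos_semidef_add pos_semidef_congruence)

text \<open>The terms of a summable sequence are eventually below 1, where a square lies below its
  root.\<close>

lemma summable_closed_loop_square:
  assumes "K \<in> stabilizing A B"
  shows "summable (\<lambda>t. (norm (closed_loop A B K x t))\<^sup>2)"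
proof -
  have s: "summable (\<lambda>t. norm (closed_loop A B K x t))"
    unfolding closed_loop_mpow using assms by (intro summable_norm_powers) (simp add: stabilizing_def)
  then have "(\<lambda>t. norm (closed_loop A B K x t)) \<longlonglongrightarrow> 0"
    by (rule summable_LIMSEQ_zero)
  then have "\<forall>\<^sub>F t in sequentially. norm (closed_loop A B K x t) < 1"
    by (rule order_tendstoD) simp
  then have "\<forall>\<^sub>F t in sequentially.
      norm ((norm (closed_loop A B K x t))\<^sup>2) \<le> norm (closed_loop A B K x t)"
  proof eventually_elim
    case (elim t)
    then show ?case
      using mult_left_le[of "norm (closed_loop A B K x t)" "norm (closed_loop A B K x t)"]
      by (simp add: power2_eq_square)
  qed
  then show ?thesis
    using s by (rule summable_comparison_test_ev)
qed

lemma summable_qf_closed_loop: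
  assumes "K \<in> stabilizing A B"
  shows "summable (\<lambda>t. qf W (closed_loop A B K x t))"
  using summable_mult[OF summable_closed_loop_square[OF assms, of x], of "norm W"]
  by (rule summable_comparison_test'[where N = 0]) (simp add: abs_qf_le)

lemma sums_qf_telescope:
  assumes "K \<in> stabilizing A B"
  shows "(\<lambda>t. qf X (closed_loop A B K x t) - qf X (closed_loop A B K x (Suc t))) sums qf X x"
  using telescope_sums'[OF summable_LIMSEQ_zero[OF summable_qf_closed_loop[OF assms, of X x]]]
  by simp

section \<open>Costs per initial state, their trace and the expectation\<close>

definition run_cost :: "real^'n^'n \<Rightarrow> real^'m^'n \<Rightarrow> real^'n^'n \<Rightarrow> real^'m^'m \<Rightarrow> real^'n^'m \<Rightarrow> real^'n \<Rightarrow> real"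
  where "run_cost A B Q R K x = (\<Sum>t. qf (weight Q R K) (closed_loop A B K x t))"

text \<open>For stabilizing K and semidefinite weights the run cost is a quadratic form, and this is
  the trace of its matrix: the expected cost, freed from the probability space.\<close>

definition total_cost :: "real^'n^'n \<Rightarrow> real^'m^'n \<Rightarrow> real^'n^'n \<Rightarrow> real^'m^'m \<Rightarrow> real^'n^'m \<Rightarrow> real"
  where "total_cost A B Q R K = (\<Sum>i\<in>UNIV. run_cost A B Q R K (axis i 1))"

lemma stage_cost_weight: "stage_cost Q R x (- (K *v x)) = qf (weight Q R K) x"
  by (simp add: stage_cost_qf qf_weight)

text \<open>The partial sums are quadratic forms of symmetric matrices and converge at every x.
  Hence the matrices converge, and the infinite sum is again a single quadratic form.\<close>

lemma lyapunov_matrix: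
  assumes K: "K \<in> stabilizing A B" and W: "pos_semidef W"
  obtains P where "\<And>x. (\<lambda>t. qf W (closed_loop A B K x t)) sums qf P x"
proof -
  let ?F = "\<lambda>t. mpow (A - B ** K) t"
  define P where "P T = (\<Sum>t<T. transpose (?F t) ** W ** ?F t)" for T
  have qfP: "qf (P T) x = (\<Sum>t<T. qf W (closed_loop A B K x t))" for T x
    unfolding P_def qf_sum_matrix qf_congruence closed_loop_mpow ..
  have lim: "(\<lambda>T. qf (P T) x) \<longlonglongrightarrow> (\<Sum>t. qf W (closed_loop A B K x t))" for x
    unfolding qfP by (rule summable_LIMSEQ[OF summable_qf_closed_loop[OF K]])
  have "pos_semidef (P T)" for T
    unfolding P_def by (intro pos_semidef_sum pos_semidef_congruence W)
  then obtain L where L: "P \<longlonglongrightarrow> L"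
    using symmetric_matrix_convergent[of P] pos_semidef_symmetric lim convergentI by metis
  have "(\<lambda>t. qf W (closed_loop A B K x t)) sums qf L x" for x
    unfolding sums_def qfP[symmetric] by (intro tendsto_qf L tendsto_const)
  then show thesis
    by (rule that)
qed

text \<open>Split off the term t = 0; the others belong to the trajectory that starts at the next
  state.\<close>

lemma lyapunov_equation:
  assumes "\<And>x. (\<lambda>t. qf W (closed_loop A B K x t)) sums qf P x"
  shows "qf P x = qf W x + qf P ((A - B ** K) *v x)"
proof -
  have "(\<lambda>t. qf W (closed_loop A B K x (Suc t))) sums qf P ((A - B ** K) *v x)"
    unfolding closed_loop_Suc_shift by (rule assms)
  then have "(\<lambda>t. qf W (closed_loop A B K x t)) sums (qf P ((A - B ** K) *v x) + qf W x)"
    using sums_Suc[of "\<lambda>t. qf W (closed_loop A B K x t)"] by fastforce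
  then show ?thesis
    using sums_unique2[OF assms[of x]] by simp
qed

lemma run_cost_qf:
  assumes "K \<in> stabilizing A B" "pos_semidef Q" "pos_semidef R"
  obtains P where "run_cost A B Q R K = qf P"
proof -
  obtain P where "\<And>x. (\<lambda>t. qf (weight Q R K) (closed_loop A B K x t)) sums qf P x"
    using lyapunov_matrix[OF assms(1) pos_semidef_weight[OF assms(2,3)]] by blast
  then have "run_cost A B Q R K = qf P"
    unfolding run_cost_def by (intro ext) (rule sums_unique[symmetric])
  then show thesis
    by (rule that)
qed

lemma run_cost_nonneg:
  assumes "K \<in> stabilizing A B" "pos_semidef Q" "pos_semidef R"
  shows "0 \<le> run_cost A B Q R K x"
  unfolding run_cost_def using assms
  by (intro suminf_nonneg summable_qf_closed_loop pos_semidef_nonneg pos_semidef_weight)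

lemma total_cost_nonneg:
  assumes "K \<in> stabilizing A B" "pos_semidef Q" "pos_semidef R"
  shows "0 \<le> total_cost A B Q R K"
  unfolding total_cost_def by (intro sum_nonneg run_cost_nonneg assms)

text \<open>\<open>qf P x\<close> is linear in \<open>outer x\<close>, so its expectation is the
  trace of P times the second moment.\<close>

lemma integral_qf:
  fixes P :: "real^'n^'n"
  assumes "(\<integral>w. outer (x0 w) \<partial>M) = mat 1"
  shows "(\<integral>w. qf P (x0 w) \<partial>M) = (\<Sum>i\<in>UNIV. qf P (axis i 1))"
proof -
  \<comment> \<open>The integral of a non-integrable function is 0 by convention, so a nonzero value
    already yields integrability.\<close>
  have "(mat 1 :: real^'n^'n) \<noteq> 0"
    by (auto simp: vec_eq_iff mat_def)
  then have int: "integrable M (\<lambda>w. outer (x0 w))"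
    using assms not_integrable_integral_eq by metis
  have bl: "bounded_linear (\<lambda>X :: real^'n^'n. X $ i $ j)" for i j
    using bounded_linear_compose[OF bounded_linear_vec_nth bounded_linear_vec_nth] .
  have int': "integrable M (\<lambda>w. outer (x0 w) $ i $ j)" for i j
    by (rule integrable_bounded_linear[OF bl int])
  have eq: "(\<integral>w. outer (x0 w) $ i $ j \<partial>M) = (if i = j then 1 else 0)" for i j
    using integral_bounded_linear[OF bl int, of i j] assms by (simp add: mat_def)
  have "qf P x = (\<Sum>i\<in>UNIV. \<Sum>j\<in>UNIV. P $ i $ j * outer x $ i $ j)" for x
    by (simp add: qf_def inner_vec_def matrix_vector_mult_def outer_def sum_distrib_left mult_ac)
  then have "(\<integral>w. qf P (x0 w) \<partial>M) = (\<Sum>i\<in>UNIV. \<Sum>j\<in>UNIV. P $ i $ j * (if i = j then 1 else 0))"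
    using int' by (simp add: integral_sum integrable_sum eq)
  also have "\<dots> = (\<Sum>i\<in>UNIV. P $ i $ i)"
    by (simp add: if_distrib[of "(*) _"] cong: if_cong)
  also have "\<dots> = (\<Sum>i\<in>UNIV. qf P (axis i 1))"
    by (simp add: qf_def inner_axis' matrix_vector_mul_component inner_axis)
  finally show ?thesis .
qed

lemma cost_eq_total_cost:
  assumes "(\<integral>w. outer (x0 w) \<partial>M) = mat 1"
    and "K \<in> stabilizing A B" "pos_semidef Q" "pos_semidef R"
  shows "cost M x0 A B Q R K = total_cost A B Q R K"
proof -
  obtain P where "run_cost A B Q R K = qf P"
    using run_cost_qf[OF assms(2-4)] by blast
  moreover have "cost M x0 A B Q R K = (\<integral>w. run_cost A B Q R K (x0 w) \<partial>M)"
    unfolding cost_def run_cost_def by (simp add: Let_def stage_cost_weight)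
  ultimately show ?thesis
    by (simp add: total_cost_def integral_qf[OF assms(1)])
qed

lemma run_cost_linear:
  fixes l :: "'k::finite \<Rightarrow> real"
  assumes "K \<in> stabilizing A B"
  shows "run_cost A B (Q0 + (\<Sum>i\<in>UNIV. l i *\<^sub>R Q i)) (R0 + (\<Sum>i\<in>UNIV. l i *\<^sub>R R i)) K x
    = run_cost A B Q0 R0 K x + (\<Sum>i\<in>UNIV. l i * run_cost A B (Q i) (R i) K x)"
proof -
  note sums = summable_sums[OF summable_qf_closed_loop[OF assms]]
  have "qf (weight (Q0 + (\<Sum>i\<in>UNIV. l i *\<^sub>R Q i)) (R0 + (\<Sum>i\<in>UNIV. l i *\<^sub>R R i)) K) y
      = qf (weight Q0 R0 K) y + (\<Sum>i\<in>UNIV. l i * qf (weight (Q i) (R i) K) y)" for y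
    by (simp add: qf_weight qf_add_matrix qf_sum_matrix qf_scaleR_matrix distrib_left sum.distrib)
  then show ?thesis
    unfolding run_cost_def
    by (simp only:) (intro sums_unique[symmetric] sums_add sums_sum sums_mult sums)
qed

lemma total_cost_linear:
  fixes l :: "'k::finite \<Rightarrow> real"
  assumes "K \<in> stabilizing A B"
  shows "total_cost A B (Q0 + (\<Sum>i\<in>UNIV. l i *\<^sub>R Q i)) (R0 + (\<Sum>i\<in>UNIV. l i *\<^sub>R R i)) K
    = total_cost A B Q0 R0 K + (\<Sum>i\<in>UNIV. l i * total_cost A B (Q i) (R i) K)"
  unfolding total_cost_def run_cost_linear[OF assms]
  by (simp add: sum.distrib sum_distrib_left sum.swap[of _ UNIV "UNIV :: 'k set"])

text \<open>The factor b is uniform over all stabilizing gains: the weights are compared pointwise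
  as quadratic forms, before any summation along trajectories. This later keeps the constrained
  costs bounded at minimizers about which nothing else is known.\<close>

lemma total_cost_dominated:
  fixes Q0 Q :: "real^'n^'n" and R0 R :: "real^'m^'m"
  assumes "pos_def Q0" "pos_def R0"
  obtains b where "0 \<le> b"
    "\<And>K. K \<in> stabilizing A B \<Longrightarrow> total_cost A B Q R K \<le> b * total_cost A B Q0 R0 K"
proof -
  have dom: "\<exists>b\<ge>0. \<forall>x. qf N x \<le> b * qf N0 x" if "pos_def N0" for N N0 :: "real^'k^'k"
  proof -
    obtain r where r: "r > 0" "\<And>x. r * (norm x)\<^sup>2 \<le> qf N0 x"
      using pos_def_lower_bound[OF \<open>pos_def N0\<close>] by blast
    have "qf N x \<le> norm N / r * qf N0 x" for x
    proof -
      have "qf N x \<le> norm N * (norm x)\<^sup>2"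
        using abs_qf_le[of N x] by simp
      also have "\<dots> = norm N / r * (r * (norm x)\<^sup>2)"
        using r(1) by simp
      also have "\<dots> \<le> norm N / r * qf N0 x"
        using r by (intro mult_left_mono) simp_all
      finally show ?thesis .
    qed
    then show ?thesis
      using r(1) by (intro exI[of _ "norm N / r"]) simp
  qed
  obtain b1 where b1: "b1 \<ge> 0" "\<And>x. qf Q x \<le> b1 * qf Q0 x"
    using dom[OF assms(1)] by blast
  obtain b2 where b2: "b2 \<ge> 0" "\<And>x. qf R x \<le> b2 * qf R0 x"
    using dom[OF assms(2)] by blast
  have le: "qf (weight Q R K) x \<le> (b1 + b2) * qf (weight Q0 R0 K) x" for K x
  proof -
    have "0 \<le> b2 * qf Q0 x" "0 \<le> b1 * qf R0 (K *v x)"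
      using b1 b2 assms by (simp_all add: pos_semidef_nonneg pos_def_imp_pos_semidef)
    then show ?thesis
      using b1(2)[of x] b2(2)[of "K *v x"] by (simp add: qf_weight algebra_simps)
  qed
  have "total_cost A B Q R K \<le> (b1 + b2) * total_cost A B Q0 R0 K"
    if K: "K \<in> stabilizing A B" for K
    unfolding total_cost_def sum_distrib_left run_cost_def
      suminf_mult[OF summable_qf_closed_loop[OF K], symmetric]
    by (intro sum_mono suminf_le le summable_mult summable_qf_closed_loop K)
  with b1(1) b2(1) show thesis
    by (intro that[of "b1 + b2"]) simp_all
qed

text \<open>Along the loop of K' the completed squares telescope: the run cost of K' is
  \<open>qf P x\<close> plus the sum of the nonnegative excesses \<open>g\<close>. For K itself the
  excesses vanish.\<close>

lemma (in lqr) optimal_gain: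
  assumes "controllable A B"
  obtains K where "K \<in> stabilizing A B"
    "\<And>K'. K' \<in> stabilizing A B \<Longrightarrow>
      total_cost A B Q R K + (\<Sum>i\<in>UNIV. qf R ((K' - K) *v axis i 1)) \<le> total_cost A B Q R K'"
proof -
  obtain P where P: "pos_semidef P" "\<And>x. qf (riccati P) x = qf P x"
    using riccati_fixed_point[OF assms] by blast
  define K where "K = gain P"
  \<comment> \<open>The excess of one step under K' over the optimal gain, with P as the cost to
    go.\<close>
  define g where "g K' x = qf R ((K' - K) *v x) + qf P (B *v ((K' - K) *v x))" for K' x
  have square: "qf (weight Q R K') x = qf P x - qf P ((A - B ** K') *v x) + g K' x" for K' x
  proof -
    have "- (K' *v x) + K *v x = - ((K' - K) *v x)"
      by (simp add: matrix_vector_mult_diff_rdistrib)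
    moreover have "A *v x + B *v (- (K' *v x)) = (A - B ** K') *v x"
      by (simp add: matrix_vector_mult_diff_rdistrib matrix_vector_mul_assoc[symmetric]
          matrix_vector_mult_minus_right)
    ultimately show ?thesis
      using completion_of_squares[OF P(1), of x "- (K' *v x)", folded K_def]
      by (simp add: P(2) qf_weight g_def matrix_vector_mult_minus_right)
  qed
  have gK: "g K x = 0" for x
    by (simp add: g_def)
  have gR: "qf R ((K' - K) *v x) \<le> g K' x" "0 \<le> g K' x" for K' x
    using P(1) pos_def_imp_pos_semidef[OF R] by (simp_all add: g_def pos_semidef_nonneg)
  have stab: "K \<in> stabilizing A B"
  proof -
    \<comment> \<open>P is a Lyapunov function: under K it drops by at least q |x|^2 per step, so
      the squared norms are summable. This must come before any infinite sum along the loop of K is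
      used.\<close>
    obtain q where q: "q > 0" "\<And>x. q * (norm x)\<^sup>2 \<le> qf Q x"
      using pos_def_lower_bound[OF Q] by blast
    have "(\<lambda>t. closed_loop A B K x t) \<longlonglongrightarrow> 0" for x
    proof -
      let ?x = "closed_loop A B K x"
      have "summable (\<lambda>t. q * (norm (?x t))\<^sup>2)"
      proof (rule summableI_nonneg_bounded)
        fix T
        have step: "q * (norm (?x t))\<^sup>2 \<le> qf P (?x t) - qf P (?x (Suc t))" for t
          using q(2)[of "?x t"] square[of K "?x t"] pos_semidef_nonneg[OF pos_def_imp_pos_semidef[OF R], of "K *v ?x t"]
          unfolding closed_loop_Suc gK qf_weight by linarith
        have "(\<Sum>t<T. q * (norm (?x t))\<^sup>2) \<le> (\<Sum>t<T. qf P (?x t) - qf P (?x (Suc t)))"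
          by (intro sum_mono step)
        also have "\<dots> = qf P x - qf P (?x T)"
          using sum_lessThan_telescope'[of "\<lambda>t. qf P (?x t)" T] by simp
        also have "\<dots> \<le> qf P x"
          using P(1) by (simp add: pos_semidef_nonneg)
        finally show "(\<Sum>t<T. q * (norm (?x t))\<^sup>2) \<le> qf P x" .
      qed (use q in simp)
      then have "(\<lambda>t. q * (norm (?x t))\<^sup>2) \<longlonglongrightarrow> 0"
        by (rule summable_LIMSEQ_zero)
      then have "(\<lambda>t. inverse q * (q * (norm (?x t))\<^sup>2)) \<longlonglongrightarrow> 0"
        by (rule tendsto_mult_right_zero)
      then have "(\<lambda>t. (norm (?x t))\<^sup>2) \<longlonglongrightarrow> 0"
        using q(1) by (simp add: mult.assoc[symmetric])
      then have "(\<lambda>t. sqrt ((norm (?x t))\<^sup>2)) \<longlonglongrightarrow> sqrt 0"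
        by (rule tendsto_real_sqrt)
      then show ?thesis
        by (simp add: tendsto_norm_zero_iff)
    qed
    then show ?thesis
      unfolding stabilizing_def closed_loop_mpow mem_Collect_eq by (rule spectral_radius_less_1I)
  qed
  have sums: "(\<lambda>t. g K' (closed_loop A B K' x t)) sums (run_cost A B Q R K' x - qf P x)"
    if K': "K' \<in> stabilizing A B" for K' x
  proof -
    have "(\<lambda>t. qf (weight Q R K') (closed_loop A B K' x t)
        - (qf P (closed_loop A B K' x t) - qf P (closed_loop A B K' x (Suc t))))
        sums (run_cost A B Q R K' x - qf P x)"
      unfolding run_cost_def
      by (intro sums_diff summable_sums summable_qf_closed_loop sums_qf_telescope K')
    then show ?thesis
      by (simp add: square closed_loop_Suc)
  qed
  have opt: "run_cost A B Q R K x = qf P x" for x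
    using sums_unique2[OF sums_zero sums[OF stab, of x, unfolded gK]] by simp
  have "run_cost A B Q R K x + qf R ((K' - K) *v x) \<le> run_cost A B Q R K' x"
    if K': "K' \<in> stabilizing A B" for K' x
  proof -
    \<comment> \<open>Only t = 0 is kept. The state is then x itself, so the bound sees K' only
      through K' - K.\<close>
    have "(\<Sum>t\<in>{0}. g K' (closed_loop A B K' x t)) \<le> (\<Sum>t. g K' (closed_loop A B K' x t))"
      by (intro sum_le_suminf sums_summable[OF sums[OF K']]) (simp_all add: gR)
    also have "\<dots> = run_cost A B Q R K' x - qf P x"
      using sums[OF K'] by (rule sums_unique[symmetric])
    finally show ?thesis
      using gR(1)[of K' x] by (simp add: opt)
  qed
  then have "total_cost A B Q R K + (\<Sum>i\<in>UNIV. qf R ((K' - K) *v axis i 1)) \<le> total_cost A B Q R K'"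
    if "K' \<in> stabilizing A B" for K'
    unfolding total_cost_def sum.distrib[symmetric] using that by (intro sum_mono)
  with stab show thesis
    by (rule that)
qed

text \<open>If P solves the Lyapunov equation of K, its residual at a nearby gain K' is small, and the
  cost of K' differs from that of K by the accumulated residual along the trajectories of K'.\<close>

lemma continuous_on_total_cost:
  fixes A :: "real^'n^'n" and B :: "real^'m^'n"
  assumes "pos_semidef Q" "pos_semidef R"
  shows "continuous_on (stabilizing A B) (total_cost A B Q R)"
  unfolding continuous_on_def
proof
  fix K assume K: "K \<in> stabilizing A B"
  define F where "F = at K within stabilizing A B"
  \<comment> \<open>The residual at K' of the Lyapunov equation. W is a function of the gain, so
    that both the stage weight and the constant weight \<open>mat 1\<close> are covered.\<close>
  define E where "E W P K' = W K' + transpose (A - B ** K') ** P ** (A - B ** K') - P"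
    for W :: "real^'n^'m \<Rightarrow> real^'n^'n" and P K'
  have qfE: "qf W' x = qf P x - qf P ((A - B ** K') *v x) + qf (E W P K') x"
    if "W' = W K'" for W W' P K' x
    by (simp add: that E_def qf_diff_matrix qf_add_matrix qf_congruence)
  have id: "(id \<longlongrightarrow> K) F"
    unfolding F_def id_def by (rule tendsto_ident_at)
  have limE: "((\<lambda>K'. norm (E W P K' - E W P K)) \<longlongrightarrow> 0) F" if "(W \<longlongrightarrow> W K) F" for W P
  proof -
    have "((\<lambda>K'. E W P K' - E W P K) \<longlongrightarrow> E W P K - E W P K) F"
      unfolding E_def using id[unfolded id_def]
      by (intro tendsto_diff tendsto_add tendsto_matrix_matrix tendsto_transpose tendsto_const that)
    then show ?thesis
      by (simp add: tendsto_norm_zero)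
  qed
  have stab: "\<forall>\<^sub>F K' in F. K' \<in> stabilizing A B"
    unfolding F_def by (simp add: eventually_at_filter)
  obtain P where P: "\<And>x. (\<lambda>t. qf (weight Q R K) (closed_loop A B K x t)) sums qf P x"
    using lyapunov_matrix[OF K pos_semidef_weight[OF assms]] by blast
  have "pos_semidef (mat 1 :: real^'n^'n)"
    by (intro pos_semidefI) (simp_all add: qf_def)
  \<comment> \<open>X gives the total squared norm of the trajectories of K; it remains a Lyapunov
    function for nearby gains.\<close>
  then obtain X where X: "\<And>x. (\<lambda>t. qf (mat 1) (closed_loop A B K x t)) sums qf X x"
    using lyapunov_matrix[OF K] by blast
  let ?e = "\<lambda>K'. norm (E (weight Q R) P K' - E (weight Q R) P K)"
  let ?d = "\<lambda>K'. norm (E (\<lambda>_. mat 1) X K' - E (\<lambda>_. mat 1) X K)"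
  have zero: "qf (E (weight Q R) P K) x = 0" "qf (E (\<lambda>_. mat 1) X K) x = 0" for x
    using lyapunov_equation[OF P, of x] lyapunov_equation[OF X, of x]
      qfE[OF refl, of "weight Q R" K x P] qfE[OF refl, of "\<lambda>_. mat 1" K x X] by simp_all
  have small: "\<bar>qf (E (weight Q R) P K') x\<bar> \<le> ?e K' * (norm x)\<^sup>2"
    "\<bar>qf (E (\<lambda>_. mat 1) X K') x\<bar> \<le> ?d K' * (norm x)\<^sup>2" for K' x
    using abs_qf_le[of "E (weight Q R) P K' - E (weight Q R) P K" x]
      abs_qf_le[of "E (\<lambda>_. mat 1) X K' - E (\<lambda>_. mat 1) X K" x]
    by (simp_all add: qf_diff_matrix zero)
  \<comment> \<open>A residual below 1/2 leaves at least half of the decrease of X, hence the factor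
    2. The bound itself is the same for all such K'.\<close>
  have energy: "(\<Sum>t. (norm (closed_loop A B K' x t))\<^sup>2) \<le> 2 * qf X x"
    if K': "K' \<in> stabilizing A B" and d: "?d K' < 1 / 2" for K' x
  proof -
    let ?x = "closed_loop A B K' x"
    have "(norm (?x t))\<^sup>2 \<le> 2 * (qf X (?x t) - qf X (?x (Suc t)))" for t
    proof -
      have "qf (E (\<lambda>_. mat 1) X K') (?x t) \<le> ?d K' * (norm (?x t))\<^sup>2"
        using small(2)[of K' "?x t"] by simp
      also have "\<dots> \<le> 1 / 2 * (norm (?x t))\<^sup>2"
        using d by (intro mult_right_mono) simp_all
      finally have "qf (E (\<lambda>_. mat 1) X K') (?x t) \<le> 1 / 2 * (norm (?x t))\<^sup>2" .
      moreover have "qf (mat 1) (?x t) = (norm (?x t))\<^sup>2"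
        by (simp add: qf_def power2_norm_eq_inner)
      ultimately show ?thesis
        using qfE[OF refl, of "\<lambda>_. mat 1" K' "?x t" X] by (simp add: closed_loop_Suc)
    qed
    then show ?thesis
      using sums_le[OF _ summable_sums[OF summable_closed_loop_square[OF K']]
          sums_mult[OF sums_qf_telescope[OF K', of X x]]] by blast
  qed
  have diff: "\<bar>run_cost A B Q R K' x - run_cost A B Q R K x\<bar> \<le> ?e K' * (2 * qf X x)"
    if K': "K' \<in> stabilizing A B" and d: "?d K' < 1 / 2" for K' x
  proof -
    let ?x = "closed_loop A B K' x"
    have "(\<lambda>t. qf (weight Q R K') (?x t) - (qf P (?x t) - qf P (?x (Suc t))))
        sums (run_cost A B Q R K' x - qf P x)"
      unfolding run_cost_def
      by (intro sums_diff summable_sums summable_qf_closed_loop sums_qf_telescope K')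
    then have "(\<lambda>t. qf (E (weight Q R) P K') (?x t)) sums (run_cost A B Q R K' x - qf P x)"
      by (simp add: qfE[OF refl, of "weight Q R" K' _ P] closed_loop_Suc)
    moreover have "run_cost A B Q R K x = qf P x"
      unfolding run_cost_def using P by (rule sums_unique[symmetric])
    ultimately have "run_cost A B Q R K' x - run_cost A B Q R K x
        = (\<Sum>t. qf (E (weight Q R) P K') (?x t))"
      by (simp only: sums_unique)
    then have "\<bar>run_cost A B Q R K' x - run_cost A B Q R K x\<bar>
        = \<bar>\<Sum>t. qf (E (weight Q R) P K') (?x t)\<bar>"
      by (rule arg_cong)
    also have "\<dots> \<le> (\<Sum>t. ?e K' * (norm (?x t))\<^sup>2)"
      using norm_suminf_le[of "\<lambda>t. qf (E (weight Q R) P K') (?x t)" "\<lambda>t. ?e K' * (norm (?x t))\<^sup>2"]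
        small(1) summable_closed_loop_square[OF K', of x] by simp
    also have "\<dots> = ?e K' * (\<Sum>t. (norm (?x t))\<^sup>2)"
      by (rule suminf_mult[OF summable_closed_loop_square[OF K']])
    also have "\<dots> \<le> ?e K' * (2 * qf X x)"
      by (intro mult_left_mono energy K' d) simp
    finally show ?thesis .
  qed
  have "((\<lambda>K'. weight Q R K') \<longlongrightarrow> weight Q R K) F"
    unfolding weight_def using id[unfolded id_def]
    by (intro tendsto_add tendsto_matrix_matrix tendsto_transpose tendsto_const)
  then have lim: "((\<lambda>K'. \<Sum>i\<in>UNIV. ?e K' * (2 * qf X (axis i 1))) \<longlongrightarrow> 0) F"
    by (intro tendsto_null_sum tendsto_mult_left_zero limE)
  have "(?d \<longlongrightarrow> 0) F"
    by (intro limE tendsto_const)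
  then have "\<forall>\<^sub>F K' in F. ?d K' < 1 / 2"
    by (rule order_tendstoD) simp
  with stab have "\<forall>\<^sub>F K' in F. norm (total_cost A B Q R K' - total_cost A B Q R K)
      \<le> (\<Sum>i\<in>UNIV. ?e K' * (2 * qf X (axis i 1)))"
  proof eventually_elim
    case (elim K')
    show ?case
      unfolding total_cost_def sum_subtractf[symmetric] real_norm_def
      using diff[OF elim] by (intro order_trans[OF sum_abs] sum_mono)
  qed
  then have "((\<lambda>K'. total_cost A B Q R K' - total_cost A B Q R K) \<longlongrightarrow> 0) F"
    using lim by (rule Lim_null_comparison)
  then show "(total_cost A B Q R \<longlongrightarrow> total_cost A B Q R K) (at K within stabilizing A B)"
    unfolding F_def by (rule LIM_zero_cancel)
qed

section \<open>Continuity of minimizers\<close>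

text \<open>The Frobenius norm by columns; it assembles the estimates for the basis initial states
  into |K' - K|^2.\<close>

lemma norm_matrix_square: "(norm M)\<^sup>2 = (\<Sum>i\<in>UNIV. (norm (M *v axis i 1))\<^sup>2)"
  for M :: "real^'n^'m"
proof -
  have "(norm M)\<^sup>2 = (\<Sum>j\<in>UNIV. \<Sum>i\<in>UNIV. (M $ j $ i)\<^sup>2)"
    by (simp add: norm_vec_def L2_set_def sum_nonneg)
  also have "\<dots> = (\<Sum>i\<in>UNIV. \<Sum>j\<in>UNIV. (M $ j $ i)\<^sup>2)"
    by (rule sum.swap)
  also have "\<dots> = (\<Sum>i\<in>UNIV. (norm (M *v axis i 1))\<^sup>2)"
    by (simp add: norm_vec_def L2_set_def sum_nonneg matrix_vector_mul_component inner_axis)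
  finally show ?thesis .
qed

text \<open>Subtracting the inequalities for l at K' and for l' at K gives
  r |K' - K|^2 <= sum_i (l_i - l'_i) (J_i(K') - J_i(K)), and the costs J_i(K') stay bounded
  because they are dominated by J_0.\<close>

lemma continuous_on_minimizer:
  fixes S :: "'a::real_normed_vector set" and J0 :: "'a \<Rightarrow> real" and J :: "'k::finite \<Rightarrow> 'a \<Rightarrow> real"
    and T :: "(real^'k) set" and b :: "'k \<Rightarrow> real"
  assumes r: "0 < r"
    and T: "T \<subseteq> nonneg_orthant"
    and min: "\<And>l. l \<in> T \<Longrightarrow> Ks l \<in> S"
      "\<And>l K. l \<in> T \<Longrightarrow> K \<in> S \<Longrightarrow>
        J0 (Ks l) + (\<Sum>i\<in>UNIV. l $ i * J i (Ks l)) + r * (norm (K - Ks l))\<^sup>2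
        \<le> J0 K + (\<Sum>i\<in>UNIV. l $ i * J i K)"
    and J: "\<And>i K. K \<in> S \<Longrightarrow> 0 \<le> J i K" "\<And>i K. K \<in> S \<Longrightarrow> J i K \<le> b i * J0 K"
    and b: "\<And>i. 0 \<le> b i"
  shows "continuous_on T Ks"
  unfolding continuous_on_def
proof
  fix l assume l: "l \<in> T"
  define F where "F = at l within T"
  define K where "K = Ks l"
  have K: "K \<in> S"
    unfolding K_def by (rule min(1)[OF l])
  \<comment> \<open>An upper bound from which the unknown \<open>Ks l'\<close> has disappeared; it
    is continuous in l' and vanishes at l.\<close>
  define g where "g l' = (\<Sum>i\<in>UNIV. \<bar>l $ i - l' $ i\<bar> * (b i * (J0 K + (\<Sum>j\<in>UNIV. l' $ j * J j K)) + J i K))"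
    for l'
  have bound: "r * (norm (Ks l' - K))\<^sup>2 \<le> g l'" if l': "l' \<in> T" for l'
  proof -
    let ?K' = "Ks l'"
    have K': "?K' \<in> S"
      by (rule min(1)[OF l'])
    have 1: "J0 K + (\<Sum>i\<in>UNIV. l $ i * J i K) + r * (norm (?K' - K))\<^sup>2
        \<le> J0 ?K' + (\<Sum>i\<in>UNIV. l $ i * J i ?K')"
      unfolding K_def by (rule min(2)[OF l K'])
    have "0 \<le> r * (norm (K - ?K'))\<^sup>2"
      using r by simp
    then have 2: "J0 ?K' + (\<Sum>i\<in>UNIV. l' $ i * J i ?K') \<le> J0 K + (\<Sum>i\<in>UNIV. l' $ i * J i K)"
      using min(2)[OF l' K] by linarith
    \<comment> \<open>Dropping this nonnegative sum bounds \<open>J0\<close> at the unknown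
      minimizer by the Lagrangian at the fixed K.\<close>
    have "0 \<le> (\<Sum>i\<in>UNIV. l' $ i * J i ?K')"
      using l' T J(1)[OF K'] by (intro sum_nonneg mult_nonneg_nonneg) (auto simp: nonneg_orthant_def)
    then have J0: "J0 ?K' \<le> J0 K + (\<Sum>i\<in>UNIV. l' $ i * J i K)"
      using 2 by linarith
    have "r * (norm (?K' - K))\<^sup>2
        \<le> (\<Sum>i\<in>UNIV. l $ i * J i ?K') - (\<Sum>i\<in>UNIV. l $ i * J i K)
          - (\<Sum>i\<in>UNIV. l' $ i * J i ?K') + (\<Sum>i\<in>UNIV. l' $ i * J i K)"
      using 1 2 by linarith
    also have "\<dots> = (\<Sum>i\<in>UNIV. (l $ i - l' $ i) * (J i ?K' - J i K))"
      by (simp add: algebra_simps sum.distrib sum_subtractf)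
    also have "\<dots> \<le> g l'"
      unfolding g_def
    proof (rule sum_mono)
      fix i
      have "(l $ i - l' $ i) * (J i ?K' - J i K) \<le> \<bar>l $ i - l' $ i\<bar> * \<bar>J i ?K' - J i K\<bar>"
        unfolding abs_mult[symmetric] by (rule abs_ge_self)
      \<comment> \<open>A crude bound is enough, since the factor in front already tends to
        0.\<close>
      also have "\<bar>J i ?K' - J i K\<bar> \<le> J i ?K' + J i K"
        using J(1)[OF K, of i] J(1)[OF K', of i] by linarith
      also have "J i ?K' \<le> b i * (J0 K + (\<Sum>j\<in>UNIV. l' $ j * J j K))"
        using J(2)[OF K', of i] mult_left_mono[OF J0 b[of i]] by linarith
      finally show "(l $ i - l' $ i) * (J i ?K' - J i K)
          \<le> \<bar>l $ i - l' $ i\<bar> * (b i * (J0 K + (\<Sum>j\<in>UNIV. l' $ j * J j K)) + J i K)"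
        by (simp add: mult_left_mono)
    qed
    finally show ?thesis .
  qed
  have nth: "((\<lambda>l'. l' $ i) \<longlongrightarrow> l $ i) F" for i
    unfolding F_def by (intro tendsto_vec_nth tendsto_ident_at)
  have "(g \<longlongrightarrow> (\<Sum>i\<in>UNIV. \<bar>l $ i - l $ i\<bar> * (b i * (J0 K + (\<Sum>j\<in>UNIV. l $ j * J j K)) + J i K))) F"
    unfolding g_def
    by (intro tendsto_sum tendsto_mult tendsto_add tendsto_rabs tendsto_diff tendsto_const nth)
  then have "(g \<longlongrightarrow> 0) F"
    by simp
  then have "((\<lambda>l'. g l' / r) \<longlongrightarrow> 0) F"
    by (rule tendsto_divide_zero)
  then have lim: "((\<lambda>l'. sqrt (g l' / r)) \<longlongrightarrow> 0) F"
    using tendsto_real_sqrt by fastforce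
  have "\<forall>\<^sub>F l' in F. norm (Ks l' - K) \<le> sqrt (g l' / r)"
    unfolding F_def eventually_at_filter
    by (intro always_eventually allI impI real_le_rsqrt) (use bound r in \<open>simp add: field_simps\<close>)
  then have "((\<lambda>l'. Ks l' - K) \<longlongrightarrow> 0) F"
    using lim by (rule Lim_null_comparison)
  then show "(Ks \<longlongrightarrow> Ks l) (at l within T)"
    unfolding F_def K_def by (rule LIM_zero_cancel)
qed

text \<open>\<open>K_star\<close> is a \<open>THE\<close> term, so claims about it have their
  intended meaning only once existence and uniqueness are known; hence the first conjunct.\<close>

theorem lemma1:
  fixes M :: "'a measure" and x0 :: "'a \<Rightarrow> real^'n"
    and A :: "real^'n^'n" and B :: "real^'m^'n"
    and Q0 :: "real^'n^'n" and R0 :: "real^'m^'m"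
    and Q :: "'k::finite \<Rightarrow> real^'n^'n" and R :: "'k \<Rightarrow> real^'m^'m"
    and c :: "'k \<Rightarrow> real"
  assumes "prob_space M"
    and "x0 \<in> borel_measurable M"
    and "(\<integral>w. x0 w \<partial>M) = 0"
    and "(\<integral>w. outer (x0 w) \<partial>M) = mat 1"
    and "controllable A B"
    and "pos_def Q0" and "pos_def R0"
    and "\<And>i. pos_semidef (Q i)" and "\<And>i. pos_semidef (R i)"
  shows "(\<forall>l\<in>nonneg_orthant. \<exists>!K. is_minimizer M x0 A B Q0 R0 Q R c l K)
    \<and> continuous_on nonneg_orthant (K_star M x0 A B Q0 R0 Q R c)
    \<and> (\<forall>i. continuous_on nonneg_orthant
          (\<lambda>l. cost M x0 A B (Q i) (R i) (K_star M x0 A B Q0 R0 Q R c l)))"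
proof -
  let ?S = "stabilizing A B" and ?Ks = "K_star M x0 A B Q0 R0 Q R c"
  let ?min = "is_minimizer M x0 A B Q0 R0 Q R c"
  let ?H = "total_cost A B Q0 R0" and ?J = "\<lambda>i. total_cost A B (Q i) (R i)"
  \<comment> \<open>The Lagrangian without the terms in c, which do not depend on K and so leave the
    minimizer unchanged.\<close>
  define L where "L l K = ?H K + (\<Sum>i\<in>UNIV. l $ i * ?J i K)" for l :: "real^'k" and K
  note psd0 = pos_def_imp_pos_semidef[OF assms(6)] pos_def_imp_pos_semidef[OF assms(7)]
  note cost = cost_eq_total_cost[OF assms(4)]
  have lagr: "lagrangian M x0 A B Q0 R0 Q R c K l = L l K - (\<Sum>i\<in>UNIV. l $ i * c i)"
    if "K \<in> ?S" for K l
    using that by (simp add: lagrangian_def L_def cost psd0 assms(8,9) right_diff_distrib sum_subtractf)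
  obtain r where r: "r > 0" "\<And>u. r * (norm u)\<^sup>2 \<le> qf R0 u"
    using pos_def_lower_bound[OF assms(7)] by blast
  have ex: "\<exists>K\<in>?S. \<forall>K'\<in>?S. L l K + r * (norm (K' - K))\<^sup>2 \<le> L l K'"
    if l: "l \<in> nonneg_orthant" for l
  proof -
    let ?Q = "Q0 + (\<Sum>i\<in>UNIV. l $ i *\<^sub>R Q i)" and ?R = "R0 + (\<Sum>i\<in>UNIV. l $ i *\<^sub>R R i)"
    have psdR: "pos_semidef (\<Sum>i\<in>UNIV. l $ i *\<^sub>R R i)"
      using l assms(9) by (intro pos_semidef_sum pos_semidef_scaleR) (auto simp: nonneg_orthant_def)
    have "pos_semidef (\<Sum>i\<in>UNIV. l $ i *\<^sub>R Q i)"
      using l assms(8) by (intro pos_semidef_sum pos_semidef_scaleR) (auto simp: nonneg_orthant_def)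
    then interpret lqr A B ?Q ?R
      using psdR assms(6,7) by unfold_locales (simp_all add: pos_def_add)
    obtain K where K: "K \<in> ?S"
      "\<And>K'. K' \<in> ?S \<Longrightarrow> total_cost A B ?Q ?R K + (\<Sum>i\<in>UNIV. qf ?R ((K' - K) *v axis i 1))
        \<le> total_cost A B ?Q ?R K'"
      using optimal_gain[OF assms(5)] by blast
    have "L l K + r * (norm (K' - K))\<^sup>2 \<le> L l K'" if K': "K' \<in> ?S" for K'
    proof -
      have "r * (norm (K' - K))\<^sup>2 = (\<Sum>i\<in>UNIV. r * (norm ((K' - K) *v axis i 1))\<^sup>2)"
        by (simp add: norm_matrix_square sum_distrib_left)
      \<comment> \<open>The part of \<open>?R\<close> that carries the multipliers is semidefinite
        and is discarded, leaving \<open>R0\<close>.\<close>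
      also have "\<dots> \<le> (\<Sum>i\<in>UNIV. qf ?R ((K' - K) *v axis i 1))"
        using r(2) pos_semidef_nonneg[OF psdR]
        by (intro sum_mono) (simp add: qf_add_matrix add_increasing2)
      finally show ?thesis
        using K(2)[OF K'] unfolding L_def total_cost_linear[OF K'] total_cost_linear[OF K(1)]
        by linarith
    qed
    with K(1) show ?thesis
      by blast
  qed
  have unique: "\<exists>K\<in>?S. (\<forall>K'\<in>?S. L l K + r * (norm (K' - K))\<^sup>2 \<le> L l K')
      \<and> ?min l K \<and> (\<forall>K'. ?min l K' \<longrightarrow> K' = K)"
    if l: "l \<in> nonneg_orthant" for l
  proof -
    obtain K where K: "K \<in> ?S" "\<And>K'. K' \<in> ?S \<Longrightarrow> L l K + r * (norm (K' - K))\<^sup>2 \<le> L l K'"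
      using ex[OF l] by blast
    have "L l K \<le> L l K'" if "K' \<in> ?S" for K'
    proof -
      have "0 \<le> r * (norm (K' - K))\<^sup>2"
        using r(1) by simp
      then show ?thesis
        using K(2)[OF that] by linarith
    qed
    then have minK: "?min l K"
      using K(1) lagr unfolding is_minimizer_def is_arg_min_def by (fastforce simp: not_less)
    have "K' = K" if "?min l K'" for K'
    proof -
      have K': "K' \<in> ?S" and "\<not> L l K < L l K'"
        using that K(1) lagr unfolding is_minimizer_def is_arg_min_def by fastforce+
      \<comment> \<open>A second minimizer has no larger value, so quadratic growth leaves no room
        for a distance.\<close>
      then have "r * (norm (K' - K))\<^sup>2 \<le> 0"
        using K(2)[of K'] by linarith
      then show ?thesis
        using r(1) by (simp add: mult_le_0_iff)
    qed
    with K minK show ?thesis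
      by blast
  qed
  have ex1: "\<exists>!K. ?min l K" if "l \<in> nonneg_orthant" for l
    using unique[OF that] by blast
  have Ks: "?Ks l \<in> ?S \<and> (\<forall>K'\<in>?S. L l (?Ks l) + r * (norm (K' - ?Ks l))\<^sup>2 \<le> L l K')"
    if "l \<in> nonneg_orthant" for l
  proof -
    obtain K where K: "K \<in> ?S" "\<forall>K'\<in>?S. L l K + r * (norm (K' - K))\<^sup>2 \<le> L l K'"
      "?min l K" "\<forall>K'. ?min l K' \<longrightarrow> K' = K"
      using unique[OF \<open>l \<in> nonneg_orthant\<close>] by blast
    then have "?Ks l = K"
      unfolding K_star_def by (intro the_equality) blast+
    with K(1,2) show ?thesis
      by simp
  qed
  have "\<exists>b. 0 \<le> b \<and> (\<forall>K\<in>?S. ?J i K \<le> b * ?H K)" for i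
    using total_cost_dominated[OF assms(6,7), of A B "Q i" "R i"] by metis
  then obtain b where b: "\<And>i. 0 \<le> b i" "\<And>i K. K \<in> ?S \<Longrightarrow> ?J i K \<le> b i * ?H K"
    by metis
  have cont: "continuous_on nonneg_orthant ?Ks"
  proof (rule continuous_on_minimizer[of r _ ?Ks ?S ?H ?J b])
    show "0 \<le> ?J i K" if "K \<in> ?S" for i K
      using that by (intro total_cost_nonneg assms(8,9))
  qed (use r(1) Ks b in \<open>auto simp: L_def\<close>)
  have "continuous_on nonneg_orthant (\<lambda>l. cost M x0 A B (Q i) (R i) (?Ks l))" for i
  proof -
    \<comment> \<open>Both notions of cost agree at stabilizing gains, so continuity is composed for
      \<open>?J\<close> and then carried over.\<close>
    have "continuous_on nonneg_orthant (\<lambda>l. ?J i (?Ks l))"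
      using Ks by (intro continuous_on_compose2[OF continuous_on_total_cost cont] assms(8,9)) auto
    then show ?thesis
      using Ks by (simp add: cost assms(8,9) cong: continuous_on_cong_simp)
  qed
  with ex1 cont show ?thesis
    by blast
qed

end
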